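(* Let $\mathbb{F}$ be a field and let $U$ be an upper-triangular matrix of $\mathcal{M}_{Cf}(\mathbb{F})$ in which every diagonal entry equals $1$ or $-1$. Then $U$ is the product of two involutions in $\mathrm{GL}_{Cf}(\mathbb{F})$.
   Context: $\mathbb{N}$ is the set of non-negative integers. $\mathcal{M}_{Cf}(\mathbb{F})$ is the $\mathbb{F}$-algebra of column-finite matrices indexed over $\mathbb{N}$: families $(a_{i,j})_{(i,j)\in\mathbb{N}^2}$ of elements of $\mathbb{F}$ such that $\{i\in\mathbb{N}: a_{i,j}\neq 0\}$ is finite for all $j\in\mathbb{N}$, with entrywise linear operations and the usual matrix product. $I_{\mathbb{N}}$ is its unity and $\mathrm{GL}_{Cf}(\mathbb{F})$ its group of invertible elements. A matrix is upper-triangular if $a_{i,j}=0$ for all $i> j$. An involution is an element $B$ with $B^2=I_{\mathbb{N}}$. *)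

theory Defs
  imports Main "HOL-Library.Groups_Big_Fun"
begin

typedef (overloaded) 'a cf_matrix =
  "{a :: nat \<Rightarrow> nat \<Rightarrow> 'a::zero. \<forall>j. finite {i. a i j \<noteq> 0}}"
  morphisms entry Cf_Matrix
  by (rule exI[of _ "\<lambda>_ _. 0"]) simp

setup_lifting type_definition_cf_matrix

lemma finite_column: "finite {i. entry A i j \<noteq> 0}"
  using entry[of A] by blast

lemma cf_matrix_eqI: "(\<And>i j. entry A i j = entry B i j) \<Longrightarrow> A = B"
  by (rule entry_inject[THEN iffD1]) (intro ext)

lemma cf_product_eq_sum:
  fixes a b :: "nat \<Rightarrow> nat \<Rightarrow> 'a::semiring_0"
  assumes "finite K" "\<And>k. b k j \<noteq> 0 \<Longrightarrow> k \<in> K"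
  shows "Sum_any (\<lambda>k. a i k * b k j) = (\<Sum>k\<in>K. a i k * b k j)"
proof (rule Sum_any.expand_superset)
  show "{k. a i k * b k j \<noteq> 0} \<subseteq> K"
  proof
    fix k assume "k \<in> {k. a i k * b k j \<noteq> 0}"
    then have "b k j \<noteq> 0" by (auto dest: mult_not_zero)
    then show "k \<in> K" by (rule assms(2))
  qed
qed (fact assms(1))

lemma cf_product_column_finite:
  fixes a b :: "nat \<Rightarrow> nat \<Rightarrow> 'a::semiring_0"
  assumes a: "\<And>k. finite {i. a i k \<noteq> 0}" and b: "finite {k. b k j \<noteq> 0}"
  shows "finite {i. Sum_any (\<lambda>k. a i k * b k j) \<noteq> 0}"
proof (rule finite_subset)
  show "{i. Sum_any (\<lambda>k. a i k * b k j) \<noteq> 0} \<subseteq>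
      (\<Union>k\<in>{k. b k j \<noteq> 0}. {i. a i k \<noteq> 0})"
  proof
    fix i assume "i \<in> {i. Sum_any (\<lambda>k. a i k * b k j) \<noteq> 0}"
    moreover have "Sum_any (\<lambda>k. a i k * b k j) = (\<Sum>k\<in>{k. b k j \<noteq> 0}. a i k * b k j)"
      by (rule cf_product_eq_sum[OF b]) simp
    ultimately have "(\<Sum>k\<in>{k. b k j \<noteq> 0}. a i k * b k j) \<noteq> 0"
      by simp
    then obtain k where "k \<in> {k. b k j \<noteq> 0}" "a i k * b k j \<noteq> 0"
      by (rule sum.not_neutral_contains_not_neutral)
    then show "i \<in> (\<Union>k\<in>{k. b k j \<noteq> 0}. {i. a i k \<noteq> 0})"
      by (auto dest: mult_not_zero)
  qed
  show "finite (\<Union>k\<in>{k. b k j \<noteq> 0}. {i. a i k \<noteq> 0})"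
    using a b by auto
qed

instantiation cf_matrix :: (ring_1) ring_1
begin

lift_definition zero_cf_matrix :: "'a cf_matrix" is "\<lambda>i j. 0"
  by simp

lift_definition one_cf_matrix :: "'a cf_matrix" is "\<lambda>i j. if i = j then 1 else 0"
  by simp

lift_definition plus_cf_matrix :: "'a cf_matrix \<Rightarrow> 'a cf_matrix \<Rightarrow> 'a cf_matrix"
  is "\<lambda>a b i j. a i j + b i j"
proof -
  fix a b :: "nat \<Rightarrow> nat \<Rightarrow> 'a" and j
  assume "\<And>j. finite {i. a i j \<noteq> 0}" "\<And>j. finite {i. b i j \<noteq> 0}"
  then have "finite ({i. a i j \<noteq> 0} \<union> {i. b i j \<noteq> 0})" by blast
  then show "finite {i. a i j + b i j \<noteq> 0}"
    by (rule rev_finite_subset) auto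
qed

lift_definition uminus_cf_matrix :: "'a cf_matrix \<Rightarrow> 'a cf_matrix"
  is "\<lambda>a i j. - a i j"
  by simp

definition minus_cf_matrix :: "'a cf_matrix \<Rightarrow> 'a cf_matrix \<Rightarrow> 'a cf_matrix"
  where "A - B = A + - (B :: 'a cf_matrix)"

text \<open>\<^const>\<open>Sum_any\<close> sums over the indices with nonzero summand; these are finitely many
  because column \<open>j\<close> of the right factor is finite.\<close>

lift_definition times_cf_matrix :: "'a cf_matrix \<Rightarrow> 'a cf_matrix \<Rightarrow> 'a cf_matrix"
  is "\<lambda>a b i j. Sum_any (\<lambda>k. a i k * b k j)"
proof -
  fix a b :: "nat \<Rightarrow> nat \<Rightarrow> 'a" and j
  assume a: "\<And>j. finite {i. a i j \<noteq> 0}" and b: "\<And>j. finite {i. b i j \<noteq> 0}"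
  show "finite {i. Sum_any (\<lambda>k. a i k * b k j) \<noteq> 0}"
    by (rule cf_product_column_finite[OF a b])
qed

lemma entry_times_eq_sum:
  fixes A B :: "'a cf_matrix"
  assumes "finite K" "\<And>k. entry B k j \<noteq> 0 \<Longrightarrow> k \<in> K"
  shows "entry (A * B) i j = (\<Sum>k\<in>K. entry A i k * entry B k j)"
  unfolding times_cf_matrix.rep_eq by (rule cf_product_eq_sum[OF assms])

instance
proof
  fix A B C :: "'a cf_matrix"
  show "A * B * C = A * (B * C)"
  proof (rule cf_matrix_eqI)
    fix i j
    define K where "K = {k. entry C k j \<noteq> 0}"
    define L where "L = (\<Union>k\<in>K. {l. entry B l k \<noteq> 0})"
    have K: "finite K" "\<And>k. entry C k j \<noteq> 0 \<Longrightarrow> k \<in> K"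
      by (auto simp: K_def finite_column)
    have L: "finite L" "\<And>k l. k \<in> K \<Longrightarrow> entry B l k \<noteq> 0 \<Longrightarrow> l \<in> L"
      using K(1) by (auto simp: L_def finite_column)
    have BC: "entry (B * C) l j = (\<Sum>k\<in>K. entry B l k * entry C k j)" for l
      using K by (rule entry_times_eq_sum)
    have "l \<in> L" if "entry (B * C) l j \<noteq> 0" for l
    proof (rule ccontr)
      assume "l \<notin> L"
      then have "entry B l k = 0" if "k \<in> K" for k using L(2) that by blast
      then have "entry (B * C) l j = 0" unfolding BC by (intro sum.neutral) simp
      then show False using that by simp
    qed
    then have "entry (A * (B * C)) i j = (\<Sum>l\<in>L. entry A i l * entry (B * C) l j)"
      using L(1) by (intro entry_times_eq_sum)
    also have "\<dots> = (\<Sum>l\<in>L. \<Sum>k\<in>K. entry A i l * entry B l k * entry C k j)"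
      by (simp add: BC sum_distrib_left mult.assoc)
    also have "\<dots> = (\<Sum>k\<in>K. \<Sum>l\<in>L. entry A i l * entry B l k * entry C k j)"
      by (rule sum.swap)
    also have "\<dots> = (\<Sum>k\<in>K. entry (A * B) i k * entry C k j)"
    proof (rule sum.cong)
      fix k assume "k \<in> K"
      then have "entry (A * B) i k = (\<Sum>l\<in>L. entry A i l * entry B l k)"
        using L by (intro entry_times_eq_sum) auto
      then show "(\<Sum>l\<in>L. entry A i l * entry B l k * entry C k j) =
          entry (A * B) i k * entry C k j"
        by (simp add: sum_distrib_right)
    qed simp
    also have "\<dots> = entry (A * B * C) i j"
      using K by (intro entry_times_eq_sum[symmetric])
    finally show "entry (A * B * C) i j = entry (A * (B * C)) i j" by simp
  qed
  show "1 * A = A"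
  proof (rule cf_matrix_eqI)
    fix i j
    have "entry (1 * A) i j =
        (\<Sum>k\<in>insert i {k. entry A k j \<noteq> 0}. entry 1 i k * entry A k j)"
      by (rule entry_times_eq_sum) (auto simp: finite_column)
    also have "\<dots> = (\<Sum>k\<in>insert i {k. entry A k j \<noteq> 0}. if i = k then entry A k j else 0)"
      by (intro sum.cong) (auto simp: one_cf_matrix.rep_eq)
    also have "\<dots> = entry A i j"
      by (subst sum.delta') (auto simp: finite_column)
    finally show "entry (1 * A) i j = entry A i j" .
  qed
  show "A * 1 = A"
  proof (rule cf_matrix_eqI)
    fix i j
    have "entry (A * 1) i j = (\<Sum>k\<in>{j}. entry A i k * entry 1 k j)"
      by (rule entry_times_eq_sum) (auto simp: one_cf_matrix.rep_eq split: if_splits)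
    then show "entry (A * 1) i j = entry A i j"
      by (simp add: one_cf_matrix.rep_eq)
  qed
  show "(A + B) * C = A * C + B * C"
  proof (rule cf_matrix_eqI)
    fix i j
    have "entry (X * C) i j = (\<Sum>k\<in>{k. entry C k j \<noteq> 0}. entry X i k * entry C k j)"
      for X :: "'a cf_matrix"
      by (rule entry_times_eq_sum) (auto simp: finite_column)
    then show "entry ((A + B) * C) i j = entry (A * C + B * C) i j"
      by (simp add: plus_cf_matrix.rep_eq distrib_right sum.distrib)
  qed
  show "A * (B + C) = A * B + A * C"
  proof (rule cf_matrix_eqI)
    fix i j
    let ?K = "{k. entry B k j \<noteq> 0} \<union> {k. entry C k j \<noteq> 0}"
    have fin: "finite ?K" by (simp add: finite_column)
    have "entry (A * (B + C)) i j = (\<Sum>k\<in>?K. entry A i k * entry (B + C) k j)"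
      using fin by (rule entry_times_eq_sum) (auto simp: plus_cf_matrix.rep_eq)
    moreover have "entry (A * B) i j = (\<Sum>k\<in>?K. entry A i k * entry B k j)"
      using fin by (rule entry_times_eq_sum) auto
    moreover have "entry (A * C) i j = (\<Sum>k\<in>?K. entry A i k * entry C k j)"
      using fin by (rule entry_times_eq_sum) auto
    ultimately show "entry (A * (B + C)) i j = entry (A * B + A * C) i j"
      by (simp add: plus_cf_matrix.rep_eq distrib_left sum.distrib)
  qed
  show "A + B + C = A + (B + C)" "A + B = B + A" "0 + A = A" "- A + A = 0"
    by (transfer; simp add: add_ac)+
  show "A - B = A + - B" by (rule minus_cf_matrix_def)
  show "(0 :: 'a cf_matrix) \<noteq> 1"
  proof
    assume "(0 :: 'a cf_matrix) = 1"
    then have "entry (0 :: 'a cf_matrix) 0 0 = entry 1 0 0" by simp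
    then show False by (simp add: zero_cf_matrix.rep_eq one_cf_matrix.rep_eq)
  qed
qed

end

definition GL_Cf :: "'a::field cf_matrix set"
  where "GL_Cf = {A. \<exists>B. A * B = 1 \<and> B * A = 1}"

definition involution :: "'a::field cf_matrix \<Rightarrow> bool"
  where "involution B \<longleftrightarrow> B * B = 1"

definition upper_triangular :: "'a::field cf_matrix \<Rightarrow> bool"
  where "upper_triangular A \<longleftrightarrow> (\<forall>i j. i > j \<longrightarrow> entry A i j = 0)"

end

(* Put N = s u - 1 on the part of the space on which s u is locally unipotent (s = 1, -1).  If that
   part has a basis graded by degrees such that N lowers the degree by one, then S b = (- s u)^k b
   for b of degree k defines an involution with u S u = S, and u = (u S) S.

   A graded basis is built one vector at a time.  The invariant is that the height (in the sense of
   Ulm's theorem, computed in the whole space) of an element of the finite-dimensional graded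
   subspace is the minimum of the heights of its homogeneous components.  As in the Kaplansky-Mackey
   proof of Ulm's theorem, a new vector is first given maximal height modulo the subspace; but it is
   then corrected by newly adjoined homogeneous vectors until it lies in the kernel of N, where any
   degree is allowed.  Only countably many steps are needed as the dimension is countable. *)

theory Submission
  imports Defs "HOL-Computational_Algebra.Polynomial"
begin

subsection \<open>Heights\<close>

text \<open>A locally nilpotent operator on a space of countable dimension need not have a Jordan
  basis, as generalized Pruefer modules show. A graded basis asks for less: \<open>N b\<close> may
  be any combination of basis vectors one degree lower. The obstacle in building it is this. If
  \<open>N w\<close> lies in the span built so far, its homogeneous components have to be lifted
  separately, yet an image may have components that are not images at all. The invariant on heights
  excludes this: each component is at least as high as \<open>N w\<close>, so it has a preimage at
  least as high as \<open>w\<close>. As for \<open>S\<close>, the sign (-1)^k alone would conjugate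
  1 + N into 1 - N instead of the inverse of 1 + N; the powers of u repair this.\<close>

locale nilpotent_part = vector_space scale
  for scale :: "'f::field \<Rightarrow> 'v::ab_group_add \<Rightarrow> 'v" (infixr "*s" 75) +
  fixes V :: "'v set" and N :: "'v \<Rightarrow> 'v"
  assumes subspace_V: "subspace V"
    and N_add: "N (x + y) = N x + N y"
    and N_scale: "N (c *s x) = c *s N x"
    and N_in_V: "x \<in> V \<Longrightarrow> N x \<in> V"
begin

lemma linear_N: "Vector_Spaces.linear scale scale N"
  by (simp add: Vector_Spaces.linear_iff vector_space_axioms N_add N_scale)

lemma N_zero: "N 0 = 0"
  using N_scale[of 0 0] by simp

lemma N_diff: "N (x - y) = N x - N y"
  using N_add[of "x - y" y] by simp

lemma N_in_subspace_of_span: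
  assumes "\<And>b. b \<in> B \<Longrightarrow> N b \<in> W" "subspace W" "x \<in> span B"
  shows "N x \<in> W"
proof -
  interpret L: Vector_Spaces.linear scale scale N by (rule linear_N)
  have "span B \<subseteq> {x. N x \<in> W}"
    by (rule span_minimal) (use assms L.subspace_linear_preimage in auto)
  then show ?thesis using assms(3) by blast
qed

text \<open>\<open>x \<sqsubseteq> y\<close> compares the (ordinal) heights of \<open>x\<close> and \<open>y\<close> in \<open>V\<close> with respect to \<open>N\<close>; the
  coinductive definition avoids ordinals.  Elements of infinite height are those above everything.\<close>

coinductive height_le :: "'v \<Rightarrow> 'v \<Rightarrow> bool" (infix "\<sqsubseteq>" 50) where
  height_leI: "(\<And>x'. x' \<in> V \<Longrightarrow> N x' = x \<Longrightarrow> \<exists>y'\<in>V. N y' = y \<and> x' \<sqsubseteq> y') \<Longrightarrow> x \<sqsubseteq> y"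

abbreviation height_less :: "'v \<Rightarrow> 'v \<Rightarrow> bool" (infix "\<sqsubset>" 50) where
  "x \<sqsubset> y \<equiv> \<not> y \<sqsubseteq> x"

text \<open>\<open>x \<lhd> z\<close> says that the height of \<open>z\<close> is at least that of \<open>x\<close> plus one, so it
  holds for all \<open>x\<close> if \<open>z\<close> has infinite height.\<close>

definition height_below :: "'v \<Rightarrow> 'v \<Rightarrow> bool" (infix "\<lhd>" 50) where
  "x \<lhd> z \<longleftrightarrow> (\<exists>v\<in>V. N v = z \<and> x \<sqsubseteq> v)"

lemma height_leD: "x \<sqsubseteq> y \<Longrightarrow> x' \<in> V \<Longrightarrow> N x' = x \<Longrightarrow> \<exists>y'\<in>V. N y' = y \<and> x' \<sqsubseteq> y'"
  by (erule height_le.cases) blast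

lemma height_le_coinduct:
  assumes "Q x y"
    and "\<And>x y x'. Q x y \<Longrightarrow> x' \<in> V \<Longrightarrow> N x' = x \<Longrightarrow> \<exists>y'\<in>V. N y' = y \<and> Q x' y'"
  shows "x \<sqsubseteq> y"
proof (rule height_le.coinduct[of Q])
  show "Q x y" by fact
next
  fix x y assume "Q x y"
  then have "\<exists>y'\<in>V. N y' = y \<and> Q x' y'" if "x' \<in> V" "N x' = x" for x'
    using assms(2) that by blast
  then show "\<exists>a b. x = a \<and> y = b \<and>
      (\<forall>x'. x' \<in> V \<longrightarrow> N x' = a \<longrightarrow> (\<exists>y'\<in>V. N y' = b \<and> (Q x' y' \<or> x' \<sqsubseteq> y')))"
    by (intro exI[of _ x] exI[of _ y]) auto
qed

lemma height_le_refl [simp]: "x \<sqsubseteq> x"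
  by (rule height_le_coinduct[where Q = "(=)"]) auto

lemma height_le_trans [trans]: "x \<sqsubseteq> y \<Longrightarrow> y \<sqsubseteq> z \<Longrightarrow> x \<sqsubseteq> z"
  by (rule height_le_coinduct[where Q = "\<lambda>x z. \<exists>y. x \<sqsubseteq> y \<and> y \<sqsubseteq> z"])
    (use height_leD in blast)+

text \<open>\<open>0\<close> is a preimage of itself, so its chain of preimages never ends.\<close>

lemma height_le_zero [simp]: "x \<sqsubseteq> 0"
  by (rule height_le_coinduct[where Q = "\<lambda>x y. y = 0"]) (use subspace_V N_zero subspace_0 in auto)

text \<open>Preimages add up. This is the ultrametric law on which all later comparisons of heights
  rest.\<close>

lemma height_le_add: "x \<sqsubseteq> y \<Longrightarrow> x \<sqsubseteq> z \<Longrightarrow> x \<sqsubseteq> y + z"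
proof (rule height_le_coinduct[where Q = "\<lambda>x w. \<exists>y z. x \<sqsubseteq> y \<and> x \<sqsubseteq> z \<and> w = y + z"])
  fix x w x' assume "\<exists>y z. x \<sqsubseteq> y \<and> x \<sqsubseteq> z \<and> w = y + z" and x': "x' \<in> V" "N x' = x"
  then obtain y z where "x \<sqsubseteq> y" "x \<sqsubseteq> z" and w: "w = y + z" by blast
  then obtain y' z' where "y' \<in> V" "N y' = y" "x' \<sqsubseteq> y'" "z' \<in> V" "N z' = z" "x' \<sqsubseteq> z'"
    using height_leD x' by blast
  with w have "N (y' + z') = w" "y' + z' \<in> V"
    by (simp_all add: N_add subspace_add[OF subspace_V])
  with \<open>x' \<sqsubseteq> y'\<close> \<open>x' \<sqsubseteq> z'\<close>
  show "\<exists>w'\<in>V. N w' = w \<and> (\<exists>y z. x' \<sqsubseteq> y \<and> x' \<sqsubseteq> z \<and> w' = y + z)"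
    by blast
qed blast

lemma height_le_scale: "x \<sqsubseteq> y \<Longrightarrow> x \<sqsubseteq> c *s y"
proof (rule height_le_coinduct[where Q = "\<lambda>x w. \<exists>y. x \<sqsubseteq> y \<and> w = c *s y"])
  fix x w x' assume "\<exists>y. x \<sqsubseteq> y \<and> w = c *s y" and x': "x' \<in> V" "N x' = x"
  then obtain y where "x \<sqsubseteq> y" and w: "w = c *s y" by blast
  then obtain y' where "y' \<in> V" "N y' = y" "x' \<sqsubseteq> y'"
    using height_leD x' by blast
  with w have "N (c *s y') = w" "c *s y' \<in> V"
    by (simp_all add: N_scale subspace_scale[OF subspace_V])
  with \<open>x' \<sqsubseteq> y'\<close> show "\<exists>w'\<in>V. N w' = w \<and> (\<exists>y. x' \<sqsubseteq> y \<and> w' = c *s y)"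
    by blast
qed blast

lemma subspace_height_le: "subspace {y. x \<sqsubseteq> y}"
  by (auto intro!: subspaceI height_le_add height_le_scale)

lemma height_le_diff: "x \<sqsubseteq> y \<Longrightarrow> x \<sqsubseteq> z \<Longrightarrow> x \<sqsubseteq> y - z"
  using subspace_diff[OF subspace_height_le] by simp

lemma height_le_N: "x \<in> V \<Longrightarrow> x \<sqsubseteq> N x"
  by (rule height_le_coinduct[where Q = "\<lambda>x y. x \<in> V \<and> y = N x"]) auto

lemma height_below_N: "x \<in> V \<Longrightarrow> x \<lhd> N x"
  unfolding height_below_def by auto

text \<open>Stands in for successor ordinals and yields totality. If \<open>z\<close> is not below
  \<open>x\<close>, some preimage \<open>z'\<close> of \<open>z\<close> is dominated by no preimage
  of \<open>x\<close>. The relation that every preimage of the left side is strictly lower than the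
  right side is itself a simulation, whence \<open>x \<sqsubseteq> z'\<close>.\<close>

lemma height_less_below:
  assumes "x \<sqsubset> z" shows "x \<lhd> z"
proof -
  obtain z' where z': "z' \<in> V" "N z' = z" "\<forall>x'\<in>V. N x' = x \<longrightarrow> x' \<sqsubset> z'"
    using assms height_leI[of z x] by blast
  have "x \<sqsubseteq> z'"
  proof (rule height_le_coinduct[where Q = "\<lambda>x z'. \<forall>x'\<in>V. N x' = x \<longrightarrow> x' \<sqsubset> z'"])
    fix x y x' assume "\<forall>x'\<in>V. N x' = x \<longrightarrow> x' \<sqsubset> y" "x' \<in> V" "N x' = x"
    then have "x' \<sqsubset> y" by blast
    then show "\<exists>y'\<in>V. N y' = y \<and> (\<forall>x''\<in>V. N x'' = x' \<longrightarrow> x'' \<sqsubset> y')"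
      using height_leI[of y x'] by blast
  qed (use z' in blast)
  with z' show ?thesis unfolding height_below_def by blast
qed

lemma height_below_le: "x \<lhd> z \<Longrightarrow> x \<sqsubseteq> z"
  unfolding height_below_def using height_le_N height_le_trans by blast

lemma height_le_total: "x \<sqsubseteq> y \<or> y \<sqsubseteq> x"
  using height_less_below height_below_le by blast

lemma height_less_le: "x \<sqsubset> y \<Longrightarrow> x \<sqsubseteq> y"
  using height_le_total by blast

lemma height_below_le_trans: "x \<lhd> y \<Longrightarrow> y \<sqsubseteq> z \<Longrightarrow> x \<lhd> z"
  unfolding height_below_def using height_leD height_le_trans by blast

lemma infinite_height_below:
  assumes "\<And>y. y \<sqsubseteq> z" shows "x \<lhd> z"
proof -
  obtain v where "v \<in> V" "N v = z" "0 \<sqsubseteq> v"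
    using height_leD[OF assms[of 0], of 0] subspace_V subspace_0 N_zero by blast
  then show ?thesis unfolding height_below_def using height_le_trans height_le_zero by blast
qed

text \<open>As \<open>x\<close> is a preimage of \<open>N x\<close>, the hypothesis gives
  \<open>x\<close> a preimage \<open>x'\<close> with \<open>N x' = x \<sqsubseteq> x'\<close>. So it
  reproduces itself along an endless chain of preimages.\<close>

lemma infinite_height_if_N_le:
  assumes "x \<in> V" "N x \<sqsubseteq> x" shows "y \<sqsubseteq> x"
proof (rule height_le_coinduct[where Q = "\<lambda>y x. x \<in> V \<and> N x \<sqsubseteq> x"])
  fix y x y' assume "x \<in> V \<and> N x \<sqsubseteq> x"
  then show "\<exists>x'\<in>V. N x' = x \<and> x' \<in> V \<and> N x' \<sqsubseteq> x'"
    using height_leD[of "N x" x x] by auto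
qed (use assms in auto)

text \<open>Only an infinite height is its own successor, so strictness can fail only there.\<close>

lemma height_below_less_or_infinite:
  assumes "x \<lhd> z" shows "x \<sqsubset> z \<or> (\<forall>y. y \<sqsubseteq> z)"
proof (rule disjCI)
  assume "\<not> (\<forall>y. y \<sqsubseteq> z)"
  show "x \<sqsubset> z"
  proof
    assume "z \<sqsubseteq> x"
    obtain v where v: "v \<in> V" "N v = z" "x \<sqsubseteq> v" using assms unfolding height_below_def by blast
    then have "N v \<sqsubseteq> v" using \<open>z \<sqsubseteq> x\<close> height_le_trans by blast
    then have "\<forall>y. y \<sqsubseteq> z"
      using infinite_height_if_N_le[OF v(1)] v(1,2) height_le_N height_le_trans by blast
    with \<open>\<not> (\<forall>y. y \<sqsubseteq> z)\<close> show False by blast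
  qed
qed

text \<open>The upper set stands for the height as a value, so that heights can be counted with
  \<open>card\<close>. Smaller sets mean greater heights.\<close>

definition height_class :: "'v \<Rightarrow> 'v set" where
  "height_class x = {y. x \<sqsubseteq> y}"

lemma height_class_subset_iff: "height_class y \<subseteq> height_class x \<longleftrightarrow> x \<sqsubseteq> y"
  unfolding height_class_def using height_le_trans height_le_refl by blast

lemma height_class_eq_iff: "height_class y = height_class x \<longleftrightarrow> x \<sqsubseteq> y \<and> y \<sqsubseteq> x"
  using height_class_subset_iff by blast

text \<open>Adjoining one vector adds at most one height. Of two elements \<open>x\<close>,
  \<open>y\<close> with new heights, some combination \<open>u\<close> lies in the old span. If
  their heights differed, \<open>u\<close> would have the lower one by the ultrametric law, so that
  height would be old.\<close>

lemma finite_height_classes_span: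
  "finite B \<Longrightarrow> finite (height_class ` span B)"
proof (induction B rule: finite_induct)
  case (insert v B)
  show ?case
  proof (cases "\<exists>x\<in>span (insert v B). height_class x \<notin> height_class ` span B")
    case True
    then obtain x where x: "x \<in> span (insert v B)" "height_class x \<notin> height_class ` span B" by blast
    have "height_class y = height_class x"
      if y: "y \<in> span (insert v B)" "height_class y \<notin> height_class ` span B" for y
    proof -
      obtain k l where k: "x - k *s v \<in> span B" and l: "y - l *s v \<in> span B"
        using x(1) y(1) by (auto simp: span_breakdown_eq)
      have k0: "k \<noteq> 0" using k x(2) by auto
      have l0: "l \<noteq> 0" using l y(2) by auto
      define u where "u = x - (k / l) *s y"
      have "u = (x - k *s v) - (k / l) *s (y - l *s v)"
        using l0 by (simp add: u_def scale_right_diff_distrib)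
      then have u: "u \<in> span B" using k l by (auto intro: span_diff span_scale)
      have xy: "x = u + (k / l) *s y" and yx: "y = (l / k) *s (x - u)"
        using k0 l0 by (auto simp: u_def)
      show ?thesis
      proof (rule ccontr)
        assume "height_class y \<noteq> height_class x"
        then consider "x \<sqsubset> y" | "y \<sqsubset> x" unfolding height_class_eq_iff by blast
        then show False
        proof cases
          case 1
          then have "x \<sqsubseteq> u" unfolding u_def
            by (intro height_le_diff height_le_refl height_le_scale height_less_le)
          moreover have "u \<sqsubseteq> x"
          proof (rule ccontr)
            assume "x \<sqsubset> u"
            obtain m where "x \<sqsubset> m" "m \<sqsubseteq> u" "m \<sqsubseteq> y"
              using \<open>x \<sqsubset> u\<close> 1 height_le_total[of u y] height_le_refl by metis
            then have "m \<sqsubseteq> x" by (subst xy) (intro height_le_add height_le_scale)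
            with \<open>x \<sqsubset> m\<close> show False by blast
          qed
          ultimately show False using x(2) u height_class_eq_iff by blast
        next
          case 2
          have "y \<sqsubseteq> u" unfolding u_def
            using 2 by (intro height_le_diff height_le_refl height_le_scale height_less_le)
          moreover have "u \<sqsubseteq> y"
          proof (rule ccontr)
            assume "y \<sqsubset> u"
            obtain m where "y \<sqsubset> m" "m \<sqsubseteq> u" "m \<sqsubseteq> x"
              using \<open>y \<sqsubset> u\<close> 2 height_le_total[of u x] height_le_refl by metis
            then have "m \<sqsubseteq> y" by (subst yx) (intro height_le_diff height_le_scale)
            with \<open>y \<sqsubset> m\<close> show False by blast
          qed
          ultimately show False using y(2) u height_class_eq_iff by blast
        qed
      qed
    qed
    then have "height_class ` span (insert v B) \<subseteq> insert (height_class x) (height_class ` span B)"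
      by blast
    then show ?thesis using insert.IH finite_subset by blast
  next
    case False
    then have "height_class ` span (insert v B) \<subseteq> height_class ` span B" by blast
    then show ?thesis using insert.IH finite_subset by blast
  qed
qed auto

lemma exists_max_height:
  assumes "finite (height_class ` S)" "S \<noteq> {}"
  obtains m where "m \<in> S" "\<And>s. s \<in> S \<Longrightarrow> s \<sqsubseteq> m"
proof -
  obtain C where C: "C \<in> height_class ` S" "\<And>D. D \<in> height_class ` S \<Longrightarrow> D \<subseteq> C \<Longrightarrow> D = C"
    using finite_has_minimal[OF assms(1)] assms(2) by auto
  then obtain m where m: "m \<in> S" "C = height_class m" by blast
  have "s \<sqsubseteq> m" if "s \<in> S" for s
    using C(2)[of "height_class s"] that m height_le_total[of s m]
    by (auto simp: height_class_subset_iff height_class_eq_iff)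
  with m that show ?thesis by blast
qed

subsection \<open>Height-compatible gradings\<close>

text \<open>A grading is encoded by the set of pairs (homogeneous basis vector, degree).\<close>

definition hom_part :: "('v \<times> nat) set \<Rightarrow> nat \<Rightarrow> 'v set" where
  "hom_part G k = span {b. (b, k) \<in> G}"

definition other_part :: "('v \<times> nat) set \<Rightarrow> nat \<Rightarrow> 'v set" where
  "other_part G k = span {b. \<exists>j. j \<noteq> k \<and> (b, j) \<in> G}"

text \<open>The value \<open>{0}\<close> forces basis vectors of degree 0 into the kernel of
  \<open>N\<close>.\<close>

definition lower_part :: "('v \<times> nat) set \<Rightarrow> nat \<Rightarrow> 'v set" where
  "lower_part G k = (case k of 0 \<Rightarrow> {0} | Suc j \<Rightarrow> hom_part G j)"

definition graded :: "('v \<times> nat) set \<Rightarrow> bool" where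
  "graded G \<longleftrightarrow> fst ` G \<subseteq> V \<and> independent (fst ` G) \<and> inj_on fst G \<and>
    (\<forall>(b, k)\<in>G. N b \<in> lower_part G k)"

text \<open>Testing against an arbitrary \<open>g\<close> avoids naming a minimum of heights, and
  setting one degree against all others together avoids decomposing completely. Subtraction gives
  the same bound for \<open>a\<close>.\<close>

definition height_compatible :: "('v \<times> nat) set \<Rightarrow> bool" where
  "height_compatible G \<longleftrightarrow>
    (\<forall>k a c g. a \<in> other_part G k \<longrightarrow> c \<in> hom_part G k \<longrightarrow> g \<sqsubseteq> a + c \<longrightarrow> g \<sqsubseteq> c)"

definition admissible :: "('v \<times> nat) set \<Rightarrow> bool" where
  "admissible G \<longleftrightarrow> finite G \<and> graded G \<and> height_compatible G"

lemma subspace_hom_part: "subspace (hom_part G k)"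
  unfolding hom_part_def by simp

lemma subspace_other_part: "subspace (other_part G k)"
  unfolding other_part_def by simp

lemma hom_part_mono: "G \<subseteq> G' \<Longrightarrow> hom_part G k \<subseteq> hom_part G' k"
  unfolding hom_part_def by (intro span_mono) auto

lemma lower_part_mono: "G \<subseteq> G' \<Longrightarrow> lower_part G k \<subseteq> lower_part G' k"
  unfolding lower_part_def using hom_part_mono by (auto split: nat.split)

lemma hom_part_subset: "hom_part G k \<subseteq> span (fst ` G)"
  unfolding hom_part_def by (intro span_mono) force

lemma other_part_subset: "other_part G k \<subseteq> span (fst ` G)"
  unfolding other_part_def by (intro span_mono) force

lemma hom_part_subset_other: "j \<noteq> k \<Longrightarrow> hom_part G j \<subseteq> other_part G k"
  unfolding hom_part_def other_part_def by (intro span_mono) auto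

lemma span_eq_other_plus_hom:
  "span (fst ` G) = {a + c | a c. a \<in> other_part G k \<and> c \<in> hom_part G k}"
proof -
  have "fst ` G = {b. \<exists>j. j \<noteq> k \<and> (b, j) \<in> G} \<union> {b. (b, k) \<in> G}" by force
  then show ?thesis unfolding hom_part_def other_part_def by (simp only: span_Un)
qed

lemma independent_span_disjoint:
  assumes "independent S" "A \<subseteq> S" "B \<subseteq> S" "A \<inter> B = {}" "x \<in> span A" "x \<in> span B"
  shows "x = 0"
proof -
  have "representation S x b = 0" for b
    using representation_extend[OF assms(1) assms(5) assms(2)]
      representation_extend[OF assms(1) assms(6) assms(3)]
      representation_ne_zero[of A x b] representation_ne_zero[of B x b] assms(4) by auto
  moreover have "x \<in> span S" using assms(2,5) span_mono by blast
  ultimately show ?thesis using sum_nonzero_representation_eq[OF assms(1)] by fastforce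
qed

lemma hom_part_Int_other_part:
  assumes "graded G" "x \<in> hom_part G k" "x \<in> other_part G k" shows "x = 0"
proof (rule independent_span_disjoint)
  show "independent (fst ` G)" using assms(1) graded_def by blast
  show "x \<in> span {b. (b, k) \<in> G}" using assms(2) hom_part_def by blast
  show "x \<in> span {b. \<exists>j. j \<noteq> k \<and> (b, j) \<in> G}" using assms(3) other_part_def by blast
  show "{b. (b, k) \<in> G} \<inter> {b. \<exists>j. j \<noteq> k \<and> (b, j) \<in> G} = {}"
  proof -
    have "inj_on fst G" using assms(1) graded_def by blast
    then have "j = k" if "(b, k) \<in> G" "(b, j) \<in> G" for b j
      using inj_onD[of fst G "(b, k)" "(b, j)"] that by simp
    then show ?thesis by blast
  qed
qed force+

lemma span_subset_V: "graded G \<Longrightarrow> span (fst ` G) \<subseteq> V"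
  unfolding graded_def using span_minimal subspace_V by blast

lemma N_hom_part: "graded G \<Longrightarrow> c \<in> hom_part G (Suc k) \<Longrightarrow> N c \<in> hom_part G k"
  unfolding hom_part_def[of G "Suc k"]
  by (erule N_in_subspace_of_span[rotated 2])
    (auto simp: subspace_hom_part graded_def lower_part_def)

lemma N_other_part: "graded G \<Longrightarrow> a \<in> other_part G (Suc k) \<Longrightarrow> N a \<in> other_part G k"
  unfolding other_part_def[of G "Suc k"]
proof (erule N_in_subspace_of_span[rotated 2])
  fix b assume G: "graded G" and "b \<in> {b. \<exists>j. j \<noteq> Suc k \<and> (b, j) \<in> G}"
  then obtain j where "j \<noteq> Suc k" "N b \<in> lower_part G j" unfolding graded_def by blast
  then show "N b \<in> other_part G k"
    unfolding lower_part_def using hom_part_subset_other[of _ k G] subspace_0[OF subspace_other_part]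
    by (auto split: nat.splits)
qed (rule subspace_other_part)

lemma N_span: "graded G \<Longrightarrow> a \<in> span (fst ` G) \<Longrightarrow> N a \<in> span (fst ` G)"
proof (erule N_in_subspace_of_span[rotated 2])
  fix b assume G: "graded G" and "b \<in> fst ` G"
  then obtain j where "N b \<in> lower_part G j" unfolding graded_def by fastforce
  then show "N b \<in> span (fst ` G)"
    unfolding lower_part_def using hom_part_subset[of G] span_zero
    by (auto split: nat.splits)
qed simp

lemma height_compatible_hom:
  "admissible G \<Longrightarrow> a \<in> other_part G k \<Longrightarrow> c \<in> hom_part G k \<Longrightarrow> g \<sqsubseteq> a + c \<Longrightarrow> g \<sqsubseteq> c"
  unfolding admissible_def height_compatible_def by blast

lemma height_compatible_other:
  assumes "admissible G" "a \<in> other_part G k" "c \<in> hom_part G k" "g \<sqsubseteq> a + c" shows "g \<sqsubseteq> a"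
  using height_le_diff[OF assms(4) height_compatible_hom[OF assms]] by simp

lemma admissible_empty: "admissible {}"
  unfolding admissible_def graded_def height_compatible_def other_part_def hom_part_def
  by (simp add: independent_empty)

text \<open>Compatibility has to be tested only in degree \<open>m\<close> and with coefficient 1 at
  \<open>v\<close>. Other nonzero coefficients are scaled away; for a component of another degree,
  the part of degree \<open>m\<close> is subtracted first and compatibility of \<open>G\<close> then
  applies.\<close>

lemma admissible_insert:
  assumes G: "admissible G" and v: "v \<in> V" "v \<notin> span (fst ` G)" "N v \<in> lower_part G m"
    and compat: "\<And>a b g. a \<in> other_part G m \<Longrightarrow> b \<in> hom_part G m \<Longrightarrow>
      g \<sqsubseteq> a + (b + v) \<Longrightarrow> g \<sqsubseteq> b + v"
  shows "admissible (insert (v, m) G)"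
proof -
  let ?G = "insert (v, m) G"
  have gr: "graded G" and fin: "finite G" using G by (auto simp: admissible_def)
  have vG: "v \<notin> fst ` G" using v(2) span_base by blast
  have "graded ?G"
    unfolding graded_def
  proof (intro conjI ballI)
    show "fst ` ?G \<subseteq> V" using gr v(1) by (auto simp: graded_def)
    show "independent (fst ` ?G)"
      using gr v(2) independent_insertI by (simp add: graded_def)
    show "inj_on fst ?G" using gr vG by (auto simp: graded_def)
    fix p assume "p \<in> ?G"
    then have "case p of (b, k) \<Rightarrow> N b \<in> lower_part G k" using gr v(3) by (auto simp: graded_def)
    then show "case p of (b, k) \<Rightarrow> N b \<in> lower_part ?G k"
      using lower_part_mono[of G ?G] by (auto split: prod.splits)
  qed
  have om: "other_part ?G m = other_part G m"
    unfolding other_part_def by (rule arg_cong[where f = span]) auto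
  have hk: "hom_part ?G k = hom_part G k" if "k \<noteq> m" for k
    unfolding hom_part_def using that by (intro arg_cong[where f = span]) auto
  have hm: "hom_part ?G m = span (insert v {b. (b, m) \<in> G})"
    unfolding hom_part_def by (rule arg_cong[where f = span]) auto
  have main: "g \<sqsubseteq> c" if a: "a \<in> other_part G m" and c: "c \<in> hom_part ?G m" and g: "g \<sqsubseteq> a + c"
    for a c g
  proof -
    have "c \<in> span (insert v {b. (b, m) \<in> G})" using c hm by simp
    then obtain t where "c - t *s v \<in> hom_part G m"
      unfolding span_breakdown_eq hom_part_def by blast
    then obtain b where b: "b \<in> hom_part G m" and ceq: "c = b + t *s v" by (metis diff_add_cancel)
    show ?thesis
    proof (cases "t = 0")
      case True
      then show ?thesis using height_compatible_hom[OF G a b] g ceq by simp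
    next
      case False
      let ?s = "scale (inverse t)"
      have "?s (a + c) = ?s a + (?s b + v)" using False
        by (simp add: ceq scale_right_distrib)
      then have "g \<sqsubseteq> ?s a + (?s b + v)" using height_le_scale[OF g] by metis
      then have "g \<sqsubseteq> ?s b + v"
        using compat a b subspace_scale[OF subspace_other_part] subspace_scale[OF subspace_hom_part]
        by blast
      then have "g \<sqsubseteq> t *s (?s b + v)" by (rule height_le_scale)
      then show ?thesis using False by (simp add: ceq scale_right_distrib)
    qed
  qed
  have "height_compatible ?G"
    unfolding height_compatible_def
  proof (intro allI impI)
    fix k a c g
    assume a: "a \<in> other_part ?G k" and c: "c \<in> hom_part ?G k" and g: "g \<sqsubseteq> a + c"
    show "g \<sqsubseteq> c"
    proof (cases "k = m")
      case True
      then show ?thesis using main a c g om by blast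
    next
      case False
      have c': "c \<in> hom_part G k" using c hk False by blast
      have "{b. \<exists>j. j \<noteq> k \<and> (b, j) \<in> ?G} =
          {b. \<exists>j. j \<noteq> k \<and> j \<noteq> m \<and> (b, j) \<in> G} \<union> {b. (b, m) \<in> ?G}"
        using False by auto
      then have "other_part ?G k =
          {x + y | x y. x \<in> span {b. \<exists>j. j \<noteq> k \<and> j \<noteq> m \<and> (b, j) \<in> G} \<and> y \<in> hom_part ?G m}"
        unfolding other_part_def hom_part_def by (simp only: span_Un)
      then obtain x y where x: "x \<in> span {b. \<exists>j. j \<noteq> k \<and> j \<noteq> m \<and> (b, j) \<in> G}"
        and y: "y \<in> hom_part ?G m" and axy: "a = x + y" using a by blast
      have xm: "x \<in> other_part G m" and xk: "x \<in> other_part G k"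
        using x unfolding other_part_def by (auto elim: span_mono[THEN subsetD, rotated])
      have xc: "x + c \<in> other_part G m"
        using xm hom_part_subset_other[OF False] c' subspace_add[OF subspace_other_part] by blast
      have eq: "a + c = (x + c) + y" using axy by (simp add: algebra_simps)
      then have "g \<sqsubseteq> y" using main[OF xc y] g by metis
      then have "g \<sqsubseteq> x + c" using height_le_diff[OF g] eq by (metis add_diff_cancel_right')
      then show ?thesis using height_compatible_hom[OF G xk c'] by blast
    qed
  qed
  with \<open>graded ?G\<close> fin show ?thesis by (simp add: admissible_def)
qed

subsection \<open>Extending a grading\<close>

text \<open>The heights of preimages of \<open>z\<close> need not have a maximum, but only finitely
  many heights occur in \<open>span B\<close>. It suffices to exceed the highest element of
  \<open>span B\<close> that some preimage of \<open>z\<close> exceeds.\<close>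

lemma exists_high_preimage:
  assumes fin: "finite B" and xz: "x \<lhd> z"
  obtains v where "v \<in> V" "N v = z" "x \<sqsubseteq> v"
    "\<And>a y. a \<in> span B \<Longrightarrow> a \<sqsubset> y \<Longrightarrow> y \<lhd> z \<Longrightarrow> a \<sqsubset> v"
proof -
  define T where "T = {a \<in> span B. \<exists>y. a \<sqsubset> y \<and> y \<lhd> z}"
  have "finite (height_class ` T)"
    by (rule finite_subset[OF _ finite_height_classes_span[OF fin]]) (auto simp: T_def)
  show ?thesis
  proof (cases "T = {}")
    case True
    obtain v where "v \<in> V" "N v = z" "x \<sqsubseteq> v" using xz unfolding height_below_def by blast
    with True show ?thesis using that unfolding T_def by blast
  next
    case False
    then obtain m where m: "m \<in> T" "\<And>a. a \<in> T \<Longrightarrow> a \<sqsubseteq> m"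
      using exists_max_height \<open>finite (height_class ` T)\<close> by metis
    then obtain y where y: "m \<sqsubset> y" "y \<lhd> z" unfolding T_def by blast
    obtain w where w: "x \<sqsubseteq> w" "y \<sqsubseteq> w" "w \<lhd> z"
      using height_le_total[of x y] xz y(2) height_le_refl by blast
    then obtain v where v: "v \<in> V" "N v = z" "w \<sqsubseteq> v" unfolding height_below_def by blast
    have "a \<sqsubset> v" if "a \<in> span B" "a \<sqsubset> y'" "y' \<lhd> z" for a y'
    proof
      assume "v \<sqsubseteq> a"
      moreover have "a \<sqsubseteq> m" using m(2) that by (auto simp: T_def)
      ultimately show False using y(1) w(2) v(3) height_le_trans by blast
    qed
    with v w that show ?thesis using height_le_trans by blast
  qed
qed

text \<open>A homogeneous \<open>z\<close> has a homogeneous preimage of any height that \<open>z\<close> allows, after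
  enlarging the grading.  If adjoining a preimage \<open>v\<close> directly destroys compatibility, some \<open>b\<close> of
  the degree of \<open>v\<close> makes \<open>z + N b\<close> higher than \<open>z\<close>; this element is lifted by
  induction and the result corrected by \<open>- b\<close>.\<close>

lemma lift_homogeneous:
  assumes G: "admissible G"
  shows "z \<in> hom_part G k \<Longrightarrow> x \<lhd> z \<Longrightarrow>
    \<exists>G' v. admissible G' \<and> G \<subseteq> G' \<and> v \<in> hom_part G' (Suc k) \<and> N v = z \<and> x \<sqsubseteq> v \<and>
      (\<forall>a\<in>span (fst ` G'). \<exists>a0\<in>span (fst ` G). x \<sqsubseteq> a - a0) \<and>
      (z \<in> N ` span (fst ` G) \<longrightarrow> N ` span (fst ` G') \<subseteq> N ` span (fst ` G))"
proof (induction "card (height_class ` {c \<in> span (fst ` G). z \<sqsubset> c})" arbitrary: z x rule: less_induct)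
  case less
  let ?A = "span (fst ` G)"
  have gr: "graded G" and fin: "finite G" using G by (auto simp: admissible_def)
  have AV: "?A \<subseteq> V" using span_subset_V[OF gr] .
  have zA: "z \<in> ?A" using less.prems(1) hom_part_subset by blast
  obtain v where v: "v \<in> V" "N v = z" "x \<sqsubseteq> v"
    "\<And>a y. a \<in> ?A \<Longrightarrow> a \<sqsubset> y \<Longrightarrow> y \<lhd> z \<Longrightarrow> a \<sqsubset> v"
    using exists_high_preimage[OF _ less.prems(2), of "fst ` G"] fin by blast
  consider (mem) "v \<in> ?A"
    | (ext) "v \<notin> ?A" "admissible (insert (v, Suc k) G)"
    | (fail) a b g where "a \<in> other_part G (Suc k)" "b \<in> hom_part G (Suc k)"
        "g \<sqsubseteq> a + (b + v)" "b + v \<sqsubset> g"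
    using admissible_insert[OF G v(1), of "Suc k"] v(2) less.prems(1) by (auto simp: lower_part_def)
  then show ?case
  proof cases
    case mem
    \<comment> \<open>The component \<open>c\<close> already works: \<open>N a\<close> is of degree
      \<open>k\<close> and also lies in the span of the other degrees, hence vanishes.\<close>
    then obtain a c where ac: "a \<in> other_part G (Suc k)" "c \<in> hom_part G (Suc k)" "v = a + c"
      unfolding span_eq_other_plus_hom[of G "Suc k"] by blast
    have Nc: "N c \<in> hom_part G k" using N_hom_part[OF gr ac(2)] .
    have "N a = z - N c" using v(2) ac(3) N_add by (simp add: algebra_simps)
    then have "N a \<in> hom_part G k" using less.prems(1) Nc subspace_diff[OF subspace_hom_part] by simp
    then have "N a = 0" using hom_part_Int_other_part[OF gr] N_other_part[OF gr ac(1)] by blast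
    then have "N c = z" using v(2) ac(3) N_add by simp
    moreover have "x \<sqsubseteq> c" using height_compatible_hom[OF G ac(1,2)] v(3) ac(3) by blast
    moreover have "\<forall>a\<in>?A. \<exists>a0\<in>?A. x \<sqsubseteq> a - a0" by (auto intro!: bexI[where P = "\<lambda>a0. x \<sqsubseteq> _ - a0"])
    ultimately show ?thesis using G ac(2) by (intro exI[of _ G] exI[of _ c]) auto
  next
    case ext
    let ?G = "insert (v, Suc k) G"
    have sp: "\<exists>t. a - t *s v \<in> ?A" if "a \<in> span (fst ` ?G)" for a
      using that by (simp add: span_breakdown_eq)
    have "v \<in> hom_part ?G (Suc k)" unfolding hom_part_def by (rule span_base) simp
    moreover have "\<exists>a0\<in>?A. x \<sqsubseteq> a - a0" if "a \<in> span (fst ` ?G)" for a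
    proof -
      obtain t where "a - t *s v \<in> ?A" using sp \<open>a \<in> span (fst ` ?G)\<close> by blast
      moreover have "x \<sqsubseteq> a - (a - t *s v)" using height_le_scale[OF v(3)] by simp
      ultimately show ?thesis by blast
    qed
    moreover have "N ` span (fst ` ?G) \<subseteq> N ` ?A" if "z \<in> N ` ?A"
    proof clarify
      fix a assume "a \<in> span (fst ` ?G)"
      then obtain t where t: "a - t *s v \<in> ?A" using sp by blast
      obtain a1 where a1: "a1 \<in> ?A" "z = N a1" using \<open>z \<in> N ` ?A\<close> by blast
      have "N a = N ((a - t *s v) + t *s a1)" by (simp add: N_add N_diff N_scale v(2) a1(2))
      then show "N a \<in> N ` ?A" using t a1(1) span_add span_scale by blast
    qed
    ultimately show ?thesis using ext(2) v by (intro exI[of _ ?G] exI[of _ v]) auto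
  next
    case fail
    define q where "q = a + (b + v)"
    have gq: "g \<sqsubseteq> q" using fail(3) q_def by simp
    have aA: "a \<in> ?A" and bA: "b \<in> ?A"
      using fail(1,2) other_part_subset hom_part_subset by blast+
    have qV: "q \<in> V" using aA bA AV v(1) by (auto simp: q_def intro!: subspace_add[OF subspace_V])
    have ag: "a \<sqsubset> g"
    proof
      assume "g \<sqsubseteq> a"
      then have "g \<sqsubseteq> b + v" using height_le_diff[OF gq \<open>g \<sqsubseteq> a\<close>] by (simp add: q_def)
      with fail(4) show False by blast
    qed
    have aq: "a \<sqsubset> q" using ag gq height_le_trans by blast
    \<comment> \<open>\<open>a\<close> and \<open>b + v\<close> turn out to be equally high, while
      cancellation makes their sum \<open>q\<close> strictly higher.\<close>
    have abv: "a \<sqsubseteq> b + v" using height_le_diff[OF height_less_le[OF aq] height_le_refl] by (simp add: q_def)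
    have bva: "b + v \<sqsubseteq> a"
      using height_le_diff[OF height_le_trans[OF height_less_le[OF fail(4)] gq] height_le_refl]
      by (simp add: q_def)
    \<comment> \<open>\<open>z1\<close> is the component of degree \<open>k\<close> of
      \<open>N q\<close>, hence by compatibility at least as high as \<open>N q\<close>.\<close>
    define z1 where "z1 = z + N b"
    have z1: "z1 \<in> hom_part G k"
      using less.prems(1) N_hom_part[OF gr fail(2)] subspace_add[OF subspace_hom_part] z1_def by blast
    have "N q = N a + z1" using v(2) by (simp add: q_def z1_def N_add algebra_simps)
    then have "q \<lhd> z1"
    proof -
      have "N q \<sqsubseteq> z1"
        using height_compatible_hom[OF G N_other_part[OF gr fail(1)] z1] \<open>N q = N a + z1\<close> by simp
      then show ?thesis using height_below_N[OF qV] height_below_le_trans by blast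
    qed
    \<comment> \<open>If some preimage of \<open>z\<close> were higher than \<open>a\<close>, the
      choice of \<open>v\<close> would put \<open>v\<close> above \<open>a\<close>. Then
      \<open>a + b = q - v\<close> would be higher than its component \<open>a\<close>, against
      compatibility.\<close>
    have no_gap: "\<not> y \<lhd> z" if "a \<sqsubset> y" for y
    proof
      assume "y \<lhd> z"
      then have "a \<sqsubset> v" using v(4) aA that by blast
      obtain m where m: "a \<sqsubset> m" "m \<sqsubseteq> v" "m \<sqsubseteq> q"
        using height_le_total[of v q] \<open>a \<sqsubset> v\<close> aq height_le_refl by blast
      have "m \<sqsubseteq> a + b" using height_le_diff[OF m(3,2)] by (simp add: q_def algebra_simps)
      then have "m \<sqsubseteq> a" using height_compatible_other[OF G fail(1,2)] by blast
      with m(1) show False by blast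
    qed
    have zq: "z \<sqsubseteq> q" using no_gap[OF aq] height_less_below by blast
    have zz1: "z \<sqsubset> z1"
    proof
      assume "z1 \<sqsubseteq> z"
      with \<open>q \<lhd> z1\<close> have "q \<lhd> z" using height_below_le_trans by blast
      with no_gap[OF aq] show False by blast
    qed
    \<comment> \<open>The height of \<open>z1\<close> itself is counted for \<open>z\<close> but no
      longer for \<open>z1\<close>.\<close>
    have "height_class ` {c \<in> ?A. z1 \<sqsubset> c} \<subset> height_class ` {c \<in> ?A. z \<sqsubset> c}"
    proof (rule psubsetI)
      show "height_class ` {c \<in> ?A. z1 \<sqsubset> c} \<subseteq> height_class ` {c \<in> ?A. z \<sqsubset> c}"
        using zz1 height_le_trans height_less_le by blast
      have "z1 \<in> {c \<in> ?A. z \<sqsubset> c}" using z1 hom_part_subset zz1 by blast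
      moreover have "height_class z1 \<notin> height_class ` {c \<in> ?A. z1 \<sqsubset> c}"
        using height_class_eq_iff by auto
      ultimately show "height_class ` {c \<in> ?A. z1 \<sqsubset> c} \<noteq> height_class ` {c \<in> ?A. z \<sqsubset> c}" by blast
    qed
    moreover have "finite (height_class ` {c \<in> ?A. z \<sqsubset> c})"
      by (rule finite_subset[OF _ finite_height_classes_span[of "fst ` G"]]) (use fin in auto)
    ultimately have "card (height_class ` {c \<in> ?A. z1 \<sqsubset> c}) < card (height_class ` {c \<in> ?A. z \<sqsubset> c})"
      by (rule psubset_card_mono[rotated])
    from less.hyps[OF this z1 \<open>q \<lhd> z1\<close>] obtain G' v' where G': "admissible G'" "G \<subseteq> G'"
      and v': "v' \<in> hom_part G' (Suc k)" "N v' = z1" "q \<sqsubseteq> v'"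
      and app: "\<forall>a\<in>span (fst ` G'). \<exists>a0\<in>?A. q \<sqsubseteq> a - a0"
      and NA: "z1 \<in> N ` ?A \<longrightarrow> N ` span (fst ` G') \<subseteq> N ` ?A" by blast
    \<comment> \<open>The correction by \<open>b\<close> must not cost height:
      \<open>x \<sqsubseteq> v \<sqsubseteq> a \<sqsubseteq> b + v\<close>, hence
      \<open>x \<sqsubseteq> b\<close>.\<close>
    have "v \<sqsubseteq> a" using no_gap height_below_N[OF v(1)] v(2) by blast
    then have xa: "x \<sqsubseteq> a" using v(3) height_le_trans by blast
    then have xq: "x \<sqsubseteq> q" using aq height_less_le height_le_trans by blast
    have "x \<sqsubseteq> (b + v) - v" using xa abv height_le_trans v(3) height_le_diff by blast
    then have "x \<sqsubseteq> b" by simp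
    have "v' - b \<in> hom_part G' (Suc k)"
      using v'(1) fail(2) hom_part_mono[OF G'(2)] subspace_diff[OF subspace_hom_part] by blast
    moreover have "N (v' - b) = z" using v'(2) by (simp add: N_diff z1_def)
    moreover have "x \<sqsubseteq> v' - b" using xq v'(3) \<open>x \<sqsubseteq> b\<close> height_le_trans height_le_diff by blast
    moreover have "\<forall>a\<in>span (fst ` G'). \<exists>a0\<in>?A. x \<sqsubseteq> a - a0" using app xq height_le_trans by blast
    moreover have "z \<in> N ` ?A \<longrightarrow> N ` span (fst ` G') \<subseteq> N ` ?A"
    proof
      assume "z \<in> N ` ?A"
      then obtain a1 where "a1 \<in> ?A" "z = N a1" by blast
      then have "z1 = N (a1 + b)" "a1 + b \<in> ?A" using bA span_add by (auto simp: z1_def N_add)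
      then have "z1 \<in> N ` ?A" by simp
      with NA show "N ` span (fst ` G') \<subseteq> N ` ?A" by simp
    qed
    ultimately show ?thesis using G' by blast
  qed
qed

text \<open>By compatibility every component of \<open>z\<close> is at least as high as
  \<open>z\<close>, so the degrees can be lifted one at a time. The last two clauses control the
  enlargement: the span grows only by vectors at least as high as \<open>x\<close>, and
  \<open>N\<close> gains no images if \<open>z\<close> already was one. When a kernel vector is
  adjoined, the former preserves properness and the latter keeps the induction measure from
  growing.\<close>

lemma lift_sum:
  assumes "finite K"
  shows "admissible G \<Longrightarrow> z \<in> span {b. \<exists>k\<in>K. (b, k) \<in> G} \<Longrightarrow> x \<lhd> z \<Longrightarrow>
    \<exists>G' v. admissible G' \<and> G \<subseteq> G' \<and> v \<in> span (fst ` G') \<and> N v = z \<and> x \<sqsubseteq> v \<and>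
      (\<forall>a\<in>span (fst ` G'). \<exists>a0\<in>span (fst ` G). x \<sqsubseteq> a - a0) \<and>
      (z \<in> N ` span (fst ` G) \<longrightarrow> N ` span (fst ` G') \<subseteq> N ` span (fst ` G))"
  using assms
proof (induction K arbitrary: G z rule: finite_induct)
  case empty
  then have "z = 0" by simp
  have "\<exists>a0\<in>span (fst ` G). x \<sqsubseteq> a - a0" if "a \<in> span (fst ` G)" for a
    using that by (intro bexI[of _ a]) auto
  then show ?case using empty(1) \<open>z = 0\<close> span_zero N_zero
    by (intro exI[of _ G] exI[of _ 0]) auto
next
  case (insert k K)
  have gr: "graded G" using insert.prems(1) by (simp add: admissible_def)
  have "{b. \<exists>j\<in>insert k K. (b, j) \<in> G} = {b. \<exists>j\<in>K. (b, j) \<in> G} \<union> {b. (b, k) \<in> G}" by blast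
  then obtain z2 z1 where z: "z = z2 + z1" and z2: "z2 \<in> span {b. \<exists>j\<in>K. (b, j) \<in> G}"
    and z1: "z1 \<in> hom_part G k"
    using insert.prems(2) unfolding hom_part_def by (auto simp: span_Un)
  have z2o: "z2 \<in> other_part G k"
    unfolding other_part_def
    by (rule subsetD[OF span_mono z2]) (use insert.hyps(2) in auto)
  have "z \<sqsubseteq> z1" using height_compatible_hom[OF insert.prems(1) z2o z1] z by simp
  then have x1: "x \<lhd> z1" by (rule height_below_le_trans[OF insert.prems(3)])
  have "z \<sqsubseteq> z2" using height_compatible_other[OF insert.prems(1) z2o z1] z by simp
  then have x2: "x \<lhd> z2" by (rule height_below_le_trans[OF insert.prems(3)])
  obtain G1 v1 where G1: "admissible G1" "G \<subseteq> G1" "v1 \<in> hom_part G1 (Suc k)" "N v1 = z1" "x \<sqsubseteq> v1"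
    and ap1: "\<forall>a\<in>span (fst ` G1). \<exists>a0\<in>span (fst ` G). x \<sqsubseteq> a - a0"
    and N1: "z1 \<in> N ` span (fst ` G) \<longrightarrow> N ` span (fst ` G1) \<subseteq> N ` span (fst ` G)"
    using lift_homogeneous[OF insert.prems(1) z1 x1] by (elim exE conjE) (rule that; assumption)
  have "{b. \<exists>j\<in>K. (b, j) \<in> G} \<subseteq> {b. \<exists>j\<in>K. (b, j) \<in> G1}" using G1(2) by blast
  then have z2': "z2 \<in> span {b. \<exists>j\<in>K. (b, j) \<in> G1}" using z2 span_mono by blast
  obtain G2 v2 where G2: "admissible G2" "G1 \<subseteq> G2" "v2 \<in> span (fst ` G2)" "N v2 = z2" "x \<sqsubseteq> v2"
    and ap2: "\<forall>a\<in>span (fst ` G2). \<exists>a0\<in>span (fst ` G1). x \<sqsubseteq> a - a0"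
    and N2: "z2 \<in> N ` span (fst ` G1) \<longrightarrow> N ` span (fst ` G2) \<subseteq> N ` span (fst ` G1)"
    using insert.IH[OF G1(1) z2' x2] by (elim exE conjE) (rule that; assumption)
  have "v1 \<in> span (fst ` G2)"
    using G1(3) hom_part_subset hom_part_mono[OF G2(2)] by blast
  then have "v2 + v1 \<in> span (fst ` G2)" using G2(3) span_add by blast
  moreover have "N (v2 + v1) = z" using z G1(4) G2(4) by (simp add: N_add)
  moreover have "x \<sqsubseteq> v2 + v1" using G1(5) G2(5) by (rule height_le_add[rotated])
  moreover have "\<exists>a0\<in>span (fst ` G). x \<sqsubseteq> a - a0" if a: "a \<in> span (fst ` G2)" for a
  proof -
    obtain a1 where a1: "a1 \<in> span (fst ` G1)" "x \<sqsubseteq> a - a1" using ap2 a by blast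
    obtain a0 where a0: "a0 \<in> span (fst ` G)" "x \<sqsubseteq> a1 - a0" using ap1 a1(1) by blast
    have "x \<sqsubseteq> a - a0" using height_le_add[OF a1(2) a0(2)] by simp
    with a0(1) show ?thesis by blast
  qed
  moreover have "N ` span (fst ` G2) \<subseteq> N ` span (fst ` G)" if zN: "z \<in> N ` span (fst ` G)"
  proof -
    obtain y where "y \<in> span (fst ` G)" "z = N y" using zN by blast
    \<comment> \<open>Splitting the preimage at degree \<open>Suc k\<close> exhibits
      \<open>z1\<close> and \<open>z2\<close> separately as images, as \<open>N1\<close> and
      \<open>N2\<close> require.\<close>
    then obtain a c where ac: "a \<in> other_part G (Suc k)" "c \<in> hom_part G (Suc k)" "z = N (a + c)"
      unfolding span_eq_other_plus_hom[of G "Suc k"] by blast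
    have Nc: "N c \<in> hom_part G k" and Na: "N a \<in> other_part G k"
      using ac N_hom_part[OF gr] N_other_part[OF gr] by blast+
    have eq: "z1 - N c = N a - z2" using ac(3) z by (simp add: N_add algebra_simps)
    have "z1 - N c \<in> hom_part G k" using z1 Nc subspace_diff[OF subspace_hom_part] by blast
    moreover have "z1 - N c \<in> other_part G k"
      unfolding eq using z2o Na subspace_diff[OF subspace_other_part] by blast
    ultimately have "z1 - N c = 0" using hom_part_Int_other_part[OF gr] by blast
    then have "z1 = N c" "z2 = N a" using eq by auto
    moreover have "c \<in> span (fst ` G)" using ac(2) hom_part_subset by blast
    moreover have "a \<in> span (fst ` G1)"
      using ac(1) other_part_subset span_mono[OF image_mono[OF G1(2)]] by blast
    ultimately have "z1 \<in> N ` span (fst ` G)" "z2 \<in> N ` span (fst ` G1)" by simp_all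
    with N1 N2 have "N ` span (fst ` G1) \<subseteq> N ` span (fst ` G)"
      "N ` span (fst ` G2) \<subseteq> N ` span (fst ` G1)" by simp_all
    then show ?thesis by simp
  qed
  moreover have "G \<subseteq> G2" using G1(2) G2(2) by simp
  ultimately show ?case using G2(1) by (intro exI[of _ G2] exI[of _ "v2 + v1"]) simp
qed

lemma lift_span:
  assumes "admissible G" "z \<in> span (fst ` G)" "x \<lhd> z"
  obtains G' v where "admissible G'" "G \<subseteq> G'" "v \<in> span (fst ` G')" "N v = z" "x \<sqsubseteq> v"
    "\<forall>a\<in>span (fst ` G'). \<exists>a0\<in>span (fst ` G). x \<sqsubseteq> a - a0"
    "z \<in> N ` span (fst ` G) \<longrightarrow> N ` span (fst ` G') \<subseteq> N ` span (fst ` G)"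
proof -
  have "finite (snd ` G)" using assms(1) by (simp add: admissible_def)
  moreover have "fst ` G = {b. \<exists>k\<in>snd ` G. (b, k) \<in> G}" by force
  ultimately show ?thesis using lift_sum[of "snd ` G" G z x] assms that by auto
qed

section \<open>Adjoining vectors of the kernel of \<open>N\<close>\<close>

lemma adjoin_proper_kernel:
  assumes G: "admissible G" and w: "w \<in> V" "N w = 0" and proper: "\<And>a. a \<in> span (fst ` G) \<Longrightarrow> w + a \<sqsubseteq> w"
  obtains G' where "admissible G'" "G \<subseteq> G'" "w \<in> span (fst ` G')"
proof (cases "w \<in> span (fst ` G)")
  case True
  show ?thesis by (rule that[OF G subset_refl True])
next
  case False
  have admissible': "admissible (insert (w, 0) G)"
  proof (rule admissible_insert[OF G w(1) False])
    show "N w \<in> lower_part G 0" using w(2) by (simp add: lower_part_def)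
    fix a b g assume a: "a \<in> other_part G 0" and b: "b \<in> hom_part G 0" and g: "g \<sqsubseteq> a + (b + w)"
    have "a + b \<in> span (fst ` G)" using a b other_part_subset hom_part_subset span_add by blast
    \<comment> \<open>Properness splits off \<open>w\<close> first; what remains lies in the old
      span, where compatibility is known.\<close>
    from proper[OF this] have gw: "g \<sqsubseteq> w"
      using height_le_trans[OF g] by (simp add: algebra_simps)
    have "g \<sqsubseteq> a + b" using height_le_diff[OF g gw] by (simp add: algebra_simps)
    then have "g \<sqsubseteq> b" using height_compatible_hom[OF G a b] by blast
    with gw show "g \<sqsubseteq> b + w" by (rule height_le_add[rotated])
  qed
  have "w \<in> span (fst ` insert (w, 0) G)" by (rule span_base) simp
  then show ?thesis by (rule that[OF admissible' subset_insertI])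
qed

text \<open>A coset of \<open>span B\<close> lies in a finite-dimensional space, so only finitely
  many heights occur in it and one is maximal.\<close>

lemma exists_proper:
  assumes "finite B"
  obtains v where "w - v \<in> span B" "\<And>a. a \<in> span B \<Longrightarrow> v + a \<sqsubseteq> v"
proof -
  let ?S = "(\<lambda>a. w + a) ` span B"
  have "?S \<subseteq> span (insert w B)"
  proof clarify
    fix a assume "a \<in> span B"
    then have "a \<in> span (insert w B)" using span_mono[OF subset_insertI] by blast
    then show "w + a \<in> span (insert w B)" by (simp add: span_add span_base)
  qed
  then have "finite (height_class ` ?S)"
    using finite_height_classes_span[of "insert w B"] assms
    by (meson finite.insertI finite_subset image_mono)
  then obtain v where v: "v \<in> ?S" "\<And>s. s \<in> ?S \<Longrightarrow> s \<sqsubseteq> v"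
    using exists_max_height[of ?S] span_zero by blast
  then obtain a0 where a0: "a0 \<in> span B" "v = w + a0" by blast
  have "v + a \<sqsubseteq> v" if "a \<in> span B" for a
    using v(2)[of "w + (a0 + a)"] that a0 span_add by (simp add: add.assoc)
  moreover have "w - v \<in> span B" using a0 span_neg by simp
  ultimately show ?thesis using that by blast
qed

text \<open>If some height lies strictly between \<open>v\<close> and \<open>N v\<close>, the correction of \<open>v\<close> into
  the kernel of \<open>N\<close> is higher than \<open>v\<close> and thus keeps \<open>v\<close> proper.  Otherwise properness may be
  lost, but then a proper representative is so high that fewer heights of \<open>N ` span (fst ` G)\<close>,
  a space that does not grow, remain above it.\<close>

lemma adjoin_kernel_from_proper:
  "admissible G \<Longrightarrow> w \<in> V \<Longrightarrow> N w = 0 \<Longrightarrow> w - v \<in> span (fst ` G) \<Longrightarrow>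
    (\<And>a. a \<in> span (fst ` G) \<Longrightarrow> v + a \<sqsubseteq> v) \<Longrightarrow>
    \<exists>G'. admissible G' \<and> G \<subseteq> G' \<and> w \<in> span (fst ` G')"
proof (induction "card (height_class ` {c \<in> N ` span (fst ` G). v \<sqsubset> c})"
    arbitrary: G w v rule: less_induct)
  case less
  let ?A = "span (fst ` G)"
  have G: "admissible G" using less.prems(1) .
  have gr: "graded G" and fin: "finite G" using G by (auto simp: admissible_def)
  have AV: "?A \<subseteq> V" using span_subset_V[OF gr] .
  have wvA: "w - v \<in> ?A" using less.prems(4) .
  define z where "z = N v"
  have "w - (w - v) \<in> V" using less.prems(2) wvA AV by (blast intro: subspace_diff[OF subspace_V])
  then have vV: "v \<in> V" by simp
  have "z = N (- (w - v))" using less.prems(3) by (simp add: z_def N_diff)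
  moreover have "- (w - v) \<in> ?A" using wvA span_neg by blast
  ultimately have zN: "z \<in> N ` ?A" by (rule image_eqI)
  then have zA: "z \<in> ?A" using N_span[OF gr] by blast
  have finish: "\<exists>G'. admissible G' \<and> G \<subseteq> G' \<and> w \<in> span (fst ` G')"
    if "admissible G''" "G \<subseteq> G''" "v0 \<in> span (fst ` G'')" "v - v0 \<in> span (fst ` G'')" for G'' v0
  proof -
    have "w - v \<in> span (fst ` G'')" using wvA span_mono[OF image_mono[OF that(2)]] by blast
    then have "((w - v) + (v - v0)) + v0 \<in> span (fst ` G'')" using that(3,4) span_add by blast
    then show ?thesis using that(1,2) by auto
  qed
  show ?case
  proof (cases "\<exists>x. v \<sqsubset> x \<and> x \<lhd> z")
    case True
    then obtain x where x: "v \<sqsubset> x" "x \<lhd> z" by blast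
    obtain G' v0 where G': "admissible G'" "G \<subseteq> G'" and v0: "v0 \<in> span (fst ` G')" "N v0 = z" "x \<sqsubseteq> v0"
      and ap: "\<forall>a\<in>span (fst ` G'). \<exists>a0\<in>?A. x \<sqsubseteq> a - a0"
      by (rule lift_span[OF G zA x(2)]) (rule that; assumption)
    have A'V: "span (fst ` G') \<subseteq> V" using span_subset_V G'(1) admissible_def by blast
    have w1V: "v - v0 \<in> V" using vV v0(1) A'V subspace_diff[OF subspace_V] by blast
    have w1N: "N (v - v0) = 0" using v0(2) by (simp add: N_diff z_def)
    have vv0: "v \<sqsubseteq> v0" using height_le_trans[OF height_less_le[OF x(1)] v0(3)] .
    \<comment> \<open>Up to a vector at least as high as \<open>x\<close>, \<open>a'\<close> is some
      \<open>a0\<close> in the old span. If \<open>a'\<close> raised the height,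
      \<open>v + a0\<close> would be higher than \<open>v\<close>, against properness.\<close>
    have "v - v0 + a' \<sqsubseteq> v - v0" if a': "a' \<in> span (fst ` G')" for a'
    proof (rule ccontr)
      assume "v - v0 \<sqsubset> v - v0 + a'"
      moreover have "v \<sqsubseteq> v - v0" using vv0 by (intro height_le_diff) auto
      ultimately have "v \<sqsubset> v - v0 + a'" using height_le_trans by blast
      then obtain m where m: "v \<sqsubset> m" "m \<sqsubseteq> v - v0 + a'" "m \<sqsubseteq> x"
        using height_le_total[of x "v - v0 + a'"] x(1) height_le_refl by blast
      obtain a0 where a0: "a0 \<in> ?A" "x \<sqsubseteq> a' - a0" using ap a' by blast
      have "m \<sqsubseteq> (v - v0 + a') + (v0 - (a' - a0))"
        by (rule height_le_add[OF m(2) height_le_diff[OF height_le_trans[OF m(3) v0(3)]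
              height_le_trans[OF m(3) a0(2)]]])
      then have "m \<sqsubseteq> v + a0" by (simp add: algebra_simps)
      then show False using less.prems(5)[OF a0(1)] m(1) height_le_trans by blast
    qed
    then obtain G'' where "admissible G''" "G' \<subseteq> G''" "v - v0 \<in> span (fst ` G'')"
      using adjoin_proper_kernel[OF G'(1) w1V w1N] by blast
    moreover have "v0 \<in> span (fst ` G'')"
      using v0(1) span_mono[OF image_mono[OF \<open>G' \<subseteq> G''\<close>]] by blast
    ultimately show ?thesis using finish G'(2) by blast
  next
    case False
    have vz: "v \<lhd> z" using height_below_N[OF vV] z_def by simp
    obtain G' v0 where G': "admissible G'" "G \<subseteq> G'" and v0: "v0 \<in> span (fst ` G')" "N v0 = z" "v \<sqsubseteq> v0"
      and NA: "z \<in> N ` ?A \<longrightarrow> N ` span (fst ` G') \<subseteq> N ` ?A"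
      by (rule lift_span[OF G zA vz]) (rule that; assumption)
    have A'V: "span (fst ` G') \<subseteq> V" using span_subset_V G'(1) admissible_def by blast
    have w1V: "v - v0 \<in> V" using vV v0(1) A'V subspace_diff[OF subspace_V] by blast
    have w1N: "N (v - v0) = 0" using v0(2) by (simp add: N_diff z_def)
    have vw1: "v \<sqsubseteq> v - v0" using v0(3) by (intro height_le_diff) auto
    have "finite (fst ` G')" using G'(1) by (simp add: admissible_def)
    then obtain v' where v': "v - v0 - v' \<in> span (fst ` G')"
      "\<And>a. a \<in> span (fst ` G') \<Longrightarrow> v' + a \<sqsubseteq> v'" using exists_proper by blast
    have "\<exists>G''. admissible G'' \<and> G' \<subseteq> G'' \<and> v - v0 \<in> span (fst ` G'')"
    proof (cases "v' \<sqsubseteq> v")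
      case True
      have "v - v0 + a \<sqsubseteq> v - v0" if "a \<in> span (fst ` G')" for a
      proof -
        have "v' + ((v - v0 - v') + a) \<sqsubseteq> v'" using v' that span_add by blast
        then have "v - v0 + a \<sqsubseteq> v'" by (simp add: algebra_simps)
        then show ?thesis using True vw1 height_le_trans by blast
      qed
      then show ?thesis using adjoin_proper_kernel[OF G'(1) w1V w1N] by blast
    next
      case gt: False
      have nb: "\<not> v' \<lhd> z" using gt False by blast
      \<comment> \<open>The height of \<open>z\<close> is the one that leaves the count: it is above
        \<open>v\<close> but not above \<open>v'\<close>. An infinite height of \<open>z\<close> is
        ruled out by \<open>nb\<close>.\<close>
      have zv': "z \<sqsubseteq> v'" using nb height_less_below by blast
      have vz': "v \<sqsubset> z"
        using height_below_less_or_infinite[OF vz] infinite_height_below nb by blast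
      let ?X = "\<lambda>G v. height_class ` {c \<in> N ` span (fst ` G). v \<sqsubset> c}"
      have "?X G' v' \<subset> ?X G v"
      proof (rule psubsetI)
        have "{c \<in> N ` span (fst ` G'). v' \<sqsubset> c} \<subseteq> {c \<in> N ` ?A. v \<sqsubset> c}"
          using NA zN gt height_le_trans height_less_le by blast
        then show "?X G' v' \<subseteq> ?X G v" by (rule image_mono)
        have "height_class z \<in> ?X G v" using zN vz' by blast
        moreover have "height_class z \<notin> ?X G' v'"
        proof
          assume "height_class z \<in> ?X G' v'"
          then obtain c where c: "v' \<sqsubset> c" "height_class z = height_class c" by blast
          then have "c \<sqsubseteq> v'" using height_class_eq_iff height_le_trans[OF _ zv'] by blast
          with c(1) show False by blast
        qed
        ultimately show "?X G' v' \<noteq> ?X G v" by blast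
      qed
      moreover have "finite (?X G v)"
        by (rule finite_subset[OF _ finite_height_classes_span[of "fst ` G"]])
          (use fin N_span[OF gr] in auto)
      ultimately have "card (?X G' v') < card (?X G v)" by (rule psubset_card_mono[rotated])
      from less.hyps[OF this G'(1) w1V w1N v'] show ?thesis .
    qed
    then obtain G'' where "admissible G''" "G' \<subseteq> G''" "v - v0 \<in> span (fst ` G'')" by blast
    moreover have "v0 \<in> span (fst ` G'')"
      using v0(1) span_mono[OF image_mono[OF \<open>G' \<subseteq> G''\<close>]] by blast
    ultimately show ?thesis using finish G'(2) by blast
  qed
qed

lemma adjoin_kernel:
  assumes "admissible G" "w \<in> V" "N w = 0"
  obtains G' where "admissible G'" "G \<subseteq> G'" "w \<in> span (fst ` G')"
proof -
  have "finite (fst ` G)" using assms(1) by (simp add: admissible_def)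
  then obtain v where v: "w - v \<in> span (fst ` G)" "\<And>a. a \<in> span (fst ` G) \<Longrightarrow> v + a \<sqsubseteq> v"
    using exists_proper by blast
  from adjoin_kernel_from_proper[OF assms v] that show ?thesis by blast
qed

text \<open>Induction on the nilpotency index: \<open>N w\<close> is adjoined first and lifted to a
  vector \<open>v\<close> of the grading, so that only the kernel vector \<open>w - v\<close> is
  left.\<close>

lemma adjoin_nilpotent:
  "admissible G \<Longrightarrow> w \<in> V \<Longrightarrow> (N ^^ m) w = 0 \<Longrightarrow> \<exists>G'. admissible G' \<and> G \<subseteq> G' \<and> w \<in> span (fst ` G')"
proof (induction m arbitrary: w)
  case 0
  then show ?case using span_zero by auto
next
  case (Suc m)
  have "(N ^^ m) (N w) = 0" using Suc.prems(3) by (simp add: funpow_swap1)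
  then obtain G1 where G1: "admissible G1" "G \<subseteq> G1" "N w \<in> span (fst ` G1)"
    using Suc.IH[OF Suc.prems(1) N_in_V[OF Suc.prems(2)]] by blast
  obtain G2 v where G2: "admissible G2" "G1 \<subseteq> G2" and v: "v \<in> span (fst ` G2)" "N v = N w"
    by (rule lift_span[OF G1(1,3) height_below_N[OF Suc.prems(2)]]) (rule that; assumption)
  have "v \<in> V" using v(1) span_subset_V G2(1) admissible_def by blast
  then have "w - v \<in> V" "N (w - v) = 0"
    using Suc.prems(2) v(2) subspace_diff[OF subspace_V] by (auto simp: N_diff)
  then obtain G3 where G3: "admissible G3" "G2 \<subseteq> G3" "w - v \<in> span (fst ` G3)"
    using adjoin_kernel[OF G2(1)] by blast
  have "v \<in> span (fst ` G3)" using v(1) span_mono[OF image_mono[OF G3(2)]] by blast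
  then have "w \<in> span (fst ` G3)" using G3(3) span_add by fastforce
  then show ?case using G1(2) G2(2) G3(1,2) by blast
qed

text \<open>The vector \<open>e n\<close> is captured at stage \<open>Suc n\<close> of an increasing
  chain of gradings. Being graded passes to the union because every failure would show at a finite
  stage.\<close>

lemma exists_graded_basis:
  assumes nil: "\<And>w. w \<in> V \<Longrightarrow> \<exists>m. (N ^^ m) w = 0"
    and e: "V = span (range (e :: nat \<Rightarrow> 'v))"
  obtains G where "graded G" "span (fst ` G) = V"
proof -
  have eV: "e n \<in> V" for n unfolding e by (rule span_base) simp
  have "\<exists>G. \<forall>n. admissible (G n) \<and> (G n \<subseteq> G (Suc n) \<and> e n \<in> span (fst ` G (Suc n)))"
  proof (rule dependent_nat_choice)
    show "\<exists>G. admissible G" using admissible_empty by blast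
    fix G n assume "admissible G"
    moreover obtain m where "(N ^^ m) (e n) = 0" using nil eV by blast
    ultimately show "\<exists>G'. admissible G' \<and> G \<subseteq> G' \<and> e n \<in> span (fst ` G')"
      using adjoin_nilpotent eV by blast
  qed
  then obtain G where G: "\<And>n. admissible (G n)" "\<And>n. G n \<subseteq> G (Suc n)" "\<And>n. e n \<in> span (fst ` G (Suc n))"
    by blast
  have mono: "G i \<subseteq> G j" if "i \<le> j" for i j using lift_Suc_mono_le[of G, OF G(2) that] .
  have gr: "graded (G n)" for n using G(1) admissible_def by blast
  let ?G = "\<Union>n. G n"
  have fstG: "fst ` ?G = \<Union>(range (\<lambda>n. fst ` G n))" by auto
  have chain: "fst ` G i \<subseteq> fst ` G j \<or> fst ` G j \<subseteq> fst ` G i" for i j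
    using mono[of i j] mono[of j i] image_mono nat_le_linear by metis
  have "graded ?G"
    unfolding graded_def
  proof (intro conjI ballI)
    show "fst ` ?G \<subseteq> V" using gr unfolding graded_def by blast
    show "independent (fst ` ?G)"
      unfolding fstG
    proof (rule independent_Union_directed)
      show "c \<subseteq> d \<or> d \<subseteq> c" if "c \<in> range (\<lambda>n. fst ` G n)" "d \<in> range (\<lambda>n. fst ` G n)" for c d
        using that chain by blast
      show "independent c" if "c \<in> range (\<lambda>n. fst ` G n)" for c
        using that gr unfolding graded_def by blast
    qed
    show "inj_on fst ?G"
    proof (rule inj_onI)
      fix p q assume "p \<in> ?G" "q \<in> ?G" and eq: "fst p = fst q"
      then obtain i j where "p \<in> G i" "q \<in> G j" by blast
      then have "p \<in> G (max i j)" "q \<in> G (max i j)" using mono[of i "max i j"] mono[of j "max i j"] by auto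
      then show "p = q" using gr[of "max i j"] eq unfolding graded_def by (meson inj_onD)
    qed
    fix p assume "p \<in> ?G"
    then obtain n where "p \<in> G n" by blast
    then have "case p of (b, k) \<Rightarrow> N b \<in> lower_part (G n) k" using gr unfolding graded_def by blast
    then show "case p of (b, k) \<Rightarrow> N b \<in> lower_part ?G k"
      using lower_part_mono[of "G n" ?G] by (auto split: prod.splits)
  qed
  moreover have "span (fst ` ?G) = V"
  proof
    show "span (fst ` ?G) \<subseteq> V" using span_subset_V[OF \<open>graded ?G\<close>] .
    have "fst ` G (Suc n) \<subseteq> fst ` ?G" for n by blast
    then have "e n \<in> span (fst ` ?G)" for n using G(3)[of n] span_mono by blast
    then show "V \<subseteq> span (fst ` ?G)" unfolding e by (intro span_minimal) auto
  qed
  ultimately show ?thesis using that by blast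
qed

corollary exists_shift_basis:
  assumes "\<And>w. w \<in> V \<Longrightarrow> \<exists>m. (N ^^ m) w = 0" "V = span (range (e :: nat \<Rightarrow> 'v))"
  obtains B d where "independent B" "span B = V"
    "\<And>b. b \<in> B \<Longrightarrow> N b \<in> (case d b of 0 \<Rightarrow> {0} | Suc j \<Rightarrow> span {b' \<in> B. d b' = j})"
proof -
  obtain G where G: "graded G" "span (fst ` G) = V" using exists_graded_basis[OF assms] by blast
  define d where "d b = snd (inv_into G fst b)" for b
  have d: "d b = k" if "(b, k) \<in> G" for b k
  proof -
    have "inj_on fst G" using G(1) graded_def by blast
    then have "inv_into G fst (fst (b, k)) = (b, k)" using that by (rule inv_into_f_f)
    then show ?thesis by (simp add: d_def)
  qed
  have hom: "hom_part G j = span {b' \<in> fst ` G. d b' = j}" for j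
  proof -
    have "{b. (b, j) \<in> G} = {b' \<in> fst ` G. d b' = j}" using d by force
    then show ?thesis by (simp add: hom_part_def)
  qed
  have "N b \<in> (case d b of 0 \<Rightarrow> {0} | Suc j \<Rightarrow> span {b' \<in> fst ` G. d b' = j})" if b: "b \<in> fst ` G" for b
  proof -
    obtain k where k: "(b, k) \<in> G" using b by force
    then have "N b \<in> lower_part G k" using G(1) graded_def by blast
    then show ?thesis using d[OF k] hom by (simp add: lower_part_def split: nat.splits)
  qed
  moreover have "independent (fst ` G)" using G(1) graded_def by blast
  ultimately show ?thesis using that G(2) by blast
qed

end

subsection \<open>Inverting involutions\<close>

context vector_space
begin

lemma linear_funpow: "Vector_Spaces.linear scale scale f \<Longrightarrow> Vector_Spaces.linear scale scale (f ^^ n)"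
proof (induction n)
  case 0
  show ?case by (simp add: Vector_Spaces.linear_iff vector_space_axioms)
next
  case (Suc n)
  then show ?case using Vector_Spaces.linear_compose[of scale scale "f ^^ n" scale f] by (simp add: o_def)
qed

lemma linear_eq_on_span:
  assumes "Vector_Spaces.linear scale scale f" "Vector_Spaces.linear scale scale g"
    "\<And>x. x \<in> B \<Longrightarrow> f x = g x" "x \<in> span B"
  shows "f x = g x"
proof -
  interpret vector_space_pair scale scale by unfold_locales
  show ?thesis using linear_eq_on[OF assms(1,2,4,3)] .
qed

text \<open>For \<open>b\<close> of positive degree and \<open>y = \<sigma> b *s u b - b\<close>,
  the identity \<open>W b + y = - b\<close> absorbs one power of \<open>W\<close> and gives
  \<open>u S u = S\<close>. Since \<open>\<sigma> b\<close> squares to 1, this iterates to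
  \<open>W^k S W^k = S\<close>. At \<open>b\<close> with \<open>k = d b\<close> it reads
  \<open>W^k (S (S b)) = W^k b\<close>, and \<open>W\<close> is injective.\<close>

lemma exists_inverting_involution_of_basis:
  fixes u :: "'b \<Rightarrow> 'b" and \<sigma> :: "'b \<Rightarrow> 'a" and d :: "'b \<Rightarrow> nat"
  assumes u: "Vector_Spaces.linear scale scale u" and inj: "\<And>x. u x = 0 \<Longrightarrow> x = 0"
    and B: "independent B" "span B = UNIV"
    and sign: "\<And>b. b \<in> B \<Longrightarrow> \<sigma> b * \<sigma> b = 1"
    and shift: "\<And>b. b \<in> B \<Longrightarrow> \<sigma> b *s u b - b \<in>
      (case d b of 0 \<Rightarrow> {0} | Suc j \<Rightarrow> span {b' \<in> B. \<sigma> b' = \<sigma> b \<and> d b' = j})"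
  obtains S where "Vector_Spaces.linear scale scale S" "\<And>x. S (S x) = x" "\<And>x. u (S (u x)) = S x"
proof -
  interpret p: vector_space_pair scale scale by unfold_locales
  interpret u: Vector_Spaces.linear scale scale u by (rule u)
  define W where "W t x = (- t) *s u x" for t x
  have linW: "Vector_Spaces.linear scale scale (W t)" for t
    by (auto simp: W_def Vector_Spaces.linear_iff vector_space_axioms u.add u.scale scale_right_distrib)
  have linWn: "Vector_Spaces.linear scale scale (W t ^^ n)" for t n
    by (rule linear_funpow[OF linW])
  obtain S where S: "Vector_Spaces.linear scale scale S" "\<And>b. b \<in> B \<Longrightarrow> S b = (W (\<sigma> b) ^^ d b) b"
    using p.linear_independent_extend[OF B(1), of "\<lambda>b. (W (\<sigma> b) ^^ d b) b"] by blast
  interpret S: Vector_Spaces.linear scale scale S by (rule S(1))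
  have S_hom: "S y = (W t ^^ j) y" if "y \<in> span {b' \<in> B. \<sigma> b' = t \<and> d b' = j}" for t j y
    by (rule linear_eq_on_span[OF S(1) linWn _ that]) (use S(2) in auto)
  have uSu_B: "u (S (u b)) = S b" if b: "b \<in> B" for b
  proof -
    let ?s = "\<sigma> b"
    define y where "y = ?s *s u b - b"
    have ub: "u b = ?s *s (b + y)" using sign[OF b] by (simp add: y_def)
    show ?thesis
    proof (cases "d b")
      case 0
      then have "y = 0" using shift[OF b] by (simp add: y_def)
      moreover have "S b = b" using S(2)[OF b] 0 by simp
      ultimately have "S (u b) = ?s *s b" using ub by (simp add: S.scale)
      then have "u (S (u b)) = ?s *s u b" by (simp add: u.scale)
      then show ?thesis using ub \<open>y = 0\<close> sign[OF b] \<open>S b = b\<close> by simp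
    next
      case (Suc j)
      interpret Wj: Vector_Spaces.linear scale scale "W ?s ^^ j" by (rule linWn)
      have "y \<in> span {b' \<in> B. \<sigma> b' = ?s \<and> d b' = j}" using shift[OF b] Suc by (simp add: y_def)
      then have Sy: "S y = (W ?s ^^ j) y" by (rule S_hom)
      have Sb: "S b = (W ?s ^^ j) (W ?s b)" using S(2)[OF b] Suc by (simp add: funpow_swap1)
      have "S (b + y) = (W ?s ^^ j) (W ?s b + y)" by (simp add: S.add Sy Sb Wj.add)
      also have "W ?s b + y = - b" by (simp add: W_def y_def)
      finally have "S (u b) = (- ?s) *s (W ?s ^^ j) b" using ub by (simp add: S.scale Wj.neg)
      then have "u (S (u b)) = W ?s ((W ?s ^^ j) b)" by (simp add: u.scale u.neg W_def)
      then show ?thesis using Sb by (simp add: funpow_swap1)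
    qed
  qed
  have lin_uSu: "Vector_Spaces.linear scale scale (\<lambda>x. u (S (u x)))"
    using Vector_Spaces.linear_compose[OF Vector_Spaces.linear_compose[OF u S(1)] u]
    by (simp add: o_def)
  have uSu: "u (S (u x)) = S x" for x
    by (rule linear_eq_on_span[OF lin_uSu S(1) uSu_B]) (use B(2) in auto)
  have SS_B: "S (S b) = b" if b: "b \<in> B" for b
  proof -
    let ?s = "\<sigma> b"
    have s: "?s \<noteq> 0" using sign[OF b] by auto
    have WSW: "W ?s (S (W ?s x)) = S x" for x
      using uSu[of x] sign[OF b] by (simp add: W_def S.scale u.scale S.neg u.neg)
    have "(W ?s ^^ k) (S ((W ?s ^^ k) x)) = S x" for k x
      by (induction k arbitrary: x) (simp_all add: WSW funpow_swap1)
    then have "(W ?s ^^ d b) (S (S b)) = (W ?s ^^ d b) b" using S(2)[OF b] by metis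
    moreover have "inj (W ?s)"
    proof (rule injI)
      fix x y assume "W ?s x = W ?s y"
      then have "u (x - y) = 0" using s by (simp add: W_def u.diff)
      then show "x = y" using inj by fastforce
    qed
    ultimately show ?thesis by (meson inj_fn injD)
  qed
  have lin_SS: "Vector_Spaces.linear scale scale (\<lambda>x. S (S x))"
    using Vector_Spaces.linear_compose[OF S(1) S(1)] by (simp add: o_def)
  have "S (S x) = x" for x
    by (rule linear_eq_on_span[OF lin_SS module_hom_ident SS_B]) (use B(2) in auto)
  with S(1) uSu that show ?thesis by blast
qed

lemma independent_Un_of_Int_span:
  assumes "independent A" "independent B" "span A \<inter> span B = {0}"
  shows "independent (A \<union> B)"
proof
  assume "dependent (A \<union> B)"
  then obtain t c where t: "finite t" "t \<subseteq> A \<union> B" "(\<Sum>x\<in>t. c x *s x) = 0" "\<exists>x\<in>t. c x \<noteq> 0"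
    unfolding dependent_explicit by blast
  have disj: "A \<inter> B = {}"
  proof (rule ccontr)
    assume "A \<inter> B \<noteq> {}"
    then obtain x where "x \<in> A" "x \<in> B" by blast
    then have "x = 0" using assms(3) span_base by blast
    then show False using assms(1) \<open>x \<in> A\<close> dependent_zero by blast
  qed
  have tt: "t = (t \<inter> A) \<union> (t \<inter> B)" using t(2) by blast
  have "(\<Sum>x\<in>t. c x *s x) = (\<Sum>x\<in>t \<inter> A. c x *s x) + (\<Sum>x\<in>t \<inter> B. c x *s x)"
    by (subst tt, rule sum.union_disjoint) (use t(1) disj in auto)
  then have eq: "(\<Sum>x\<in>t \<inter> A. c x *s x) = - (\<Sum>x\<in>t \<inter> B. c x *s x)"
    using t(3) by (simp add: eq_neg_iff_add_eq_0)
  have a: "(\<Sum>x\<in>t \<inter> A. c x *s x) \<in> span A" by (intro span_sum span_scale span_base) auto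
  have b: "(\<Sum>x\<in>t \<inter> B. c x *s x) \<in> span B" by (intro span_sum span_scale span_base) auto
  have a0: "(\<Sum>x\<in>t \<inter> A. c x *s x) = 0" using a b span_neg eq assms(3) by (metis IntI singletonD)
  then have b0: "(\<Sum>x\<in>t \<inter> B. c x *s x) = 0" using eq by simp
  have "c x = 0" if "x \<in> t" for x
  proof (cases "x \<in> A")
    case True
    then show ?thesis using independentD[OF assms(1) _ _ a0] t(1) that by blast
  next
    case False
    then show ?thesis using independentD[OF assms(2) _ _ b0] t(1,2) that by blast
  qed
  with t(4) show False by blast
qed

section \<open>Splitting the space into the parts for the signs 1 and -1\<close>

context
  fixes u :: "'b \<Rightarrow> 'b"
  assumes u: "Vector_Spaces.linear scale scale u"
begin

interpretation u: Vector_Spaces.linear scale scale u by (rule u)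

definition shift :: "'a \<Rightarrow> 'b \<Rightarrow> 'b" where
  "shift s x = s *s u x - x"

text \<open>For \<open>s\<close> equal to 1 or -1 this is the generalized eigenspace of
  \<open>u\<close> at \<open>s\<close>.\<close>

definition unipotent_part :: "'a \<Rightarrow> 'b set" where
  "unipotent_part s = {x. \<exists>m. (shift s ^^ m) x = 0}"

lemma linear_shift: "Vector_Spaces.linear scale scale (shift s)"
  by (auto simp: shift_def Vector_Spaces.linear_iff vector_space_axioms u.add u.scale
      scale_right_distrib scale_right_diff_distrib)

interpretation shift: Vector_Spaces.linear scale scale "shift s" for s by (rule linear_shift)

interpretation shiftn: Vector_Spaces.linear scale scale "shift s ^^ m" for s m
  by (rule linear_funpow[OF linear_shift])

lemma shift_u: "shift s (u x) = u (shift s x)"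
  by (simp add: shift_def u.diff u.scale)

lemma funpow_shift_u: "(shift s ^^ m) (u x) = u ((shift s ^^ m) x)"
  by (induction m) (simp_all add: shift_u)

lemma shift_commute: "shift s (shift t x) = shift t (shift s x)"
  by (simp add: shift_def u.diff u.scale scale_right_diff_distrib algebra_simps)

lemma funpow_shift_commute: "(shift s ^^ m) (shift t x) = shift t ((shift s ^^ m) x)"
  by (induction m) (simp_all add: shift_commute)

lemma funpow_shift_eq_0_mono: "(shift s ^^ m) x = 0 \<Longrightarrow> m \<le> n \<Longrightarrow> (shift s ^^ n) x = 0"
  by (auto simp: le_iff_add add.commute[of m] funpow_add shiftn.zero)

lemma subspace_unipotent_part: "subspace (unipotent_part s)"
proof (rule subspaceI)
  show "0 \<in> unipotent_part s" by (auto simp: unipotent_part_def shiftn.zero)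
next
  fix x y assume "x \<in> unipotent_part s" "y \<in> unipotent_part s"
  then obtain m n where "(shift s ^^ m) x = 0" "(shift s ^^ n) y = 0"
    by (auto simp: unipotent_part_def)
  then have "(shift s ^^ max m n) x = 0" "(shift s ^^ max m n) y = 0"
    using funpow_shift_eq_0_mono by (meson max.cobounded1 max.cobounded2)+
  then have "(shift s ^^ max m n) (x + y) = 0" by (simp add: shiftn.add)
  then show "x + y \<in> unipotent_part s" unfolding unipotent_part_def by blast
next
  fix c x assume "x \<in> unipotent_part s"
  then obtain m where "(shift s ^^ m) x = 0" by (auto simp: unipotent_part_def)
  then have "(shift s ^^ m) (c *s x) = 0" by (simp add: shiftn.scale)
  then show "c *s x \<in> unipotent_part s" unfolding unipotent_part_def by blast
qed

lemma unipotent_partI_shift: "shift s x \<in> unipotent_part s \<Longrightarrow> x \<in> unipotent_part s"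
  unfolding unipotent_part_def by (auto intro: exI[of _ "Suc _"] simp: funpow_swap1)

lemma shift_in_unipotent_part: "x \<in> unipotent_part s \<Longrightarrow> shift t x \<in> unipotent_part s"
proof -
  assume "x \<in> unipotent_part s"
  then obtain m where "(shift s ^^ m) x = 0" by (auto simp: unipotent_part_def)
  then have "(shift s ^^ m) (shift t x) = 0" by (simp add: funpow_shift_commute shift.zero)
  then show ?thesis unfolding unipotent_part_def by blast
qed

lemma u_in_unipotent_part: "x \<in> unipotent_part s \<Longrightarrow> u x \<in> unipotent_part s"
proof -
  assume "x \<in> unipotent_part s"
  then obtain m where "(shift s ^^ m) x = 0" by (auto simp: unipotent_part_def)
  then have "(shift s ^^ m) (u x) = 0" by (simp add: funpow_shift_u u.zero)
  then show ?thesis unfolding unipotent_part_def by blast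
qed

text \<open>On the kernel of \<open>u\<close> the operator \<open>shift s\<close> is -1, whose
  powers kill only 0.\<close>

lemma u_eq_0_unipotent_part: "x \<in> unipotent_part s \<Longrightarrow> u x = 0 \<Longrightarrow> x = 0"
proof -
  assume "x \<in> unipotent_part s" and ux: "u x = 0"
  then obtain m where "(shift s ^^ m) x = 0" by (auto simp: unipotent_part_def)
  then show "x = 0" using ux
  proof (induction m arbitrary: x)
    case (Suc m)
    have sx: "shift s x = - x" using Suc.prems(2) by (simp add: shift_def)
    have "(shift s ^^ m) (- x) = 0" using Suc.prems(1) by (simp add: funpow_swap1 sx)
    then show ?case using Suc.IH[of "- x"] Suc.prems(2) u.neg by simp
  qed simp
qed

lemma shift_plus_shift_uminus: "shift s x + shift (- s) x = - (2 *s x)"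
  using scale_left_distrib[of 1 1 x] by (simp add: shift_def)

text \<open>Here \<open>shift s\<close> is -2 minus a locally nilpotent operator. If
  \<open>q1\<close> is a preimage of \<open>shift (- s) q\<close>, which has smaller index, then
  \<open>q + q1\<close> is mapped to \<open>- 2 q\<close>; hence the factor
  \<open>c\<close>.\<close>

lemma shift_onto_unipotent_part_uminus:
  assumes "(2 :: 'a) \<noteq> 0"
  shows "q \<in> unipotent_part (- s) \<Longrightarrow> \<exists>q'\<in>unipotent_part (- s). shift s q' = q"
proof -
  assume "q \<in> unipotent_part (- s)"
  then obtain m where "(shift (- s) ^^ m) q = 0" by (auto simp: unipotent_part_def)
  then show ?thesis
  proof (induction m arbitrary: q)
    case 0
    then show ?case using subspace_0[OF subspace_unipotent_part] shift.zero
      by (intro bexI[of _ 0]) auto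
  next
    case (Suc m)
    have q: "q \<in> unipotent_part (- s)" using Suc.prems unfolding unipotent_part_def by blast
    obtain q1 where q1: "q1 \<in> unipotent_part (- s)" "shift s q1 = shift (- s) q"
      using Suc.IH[of "shift (- s) q"] Suc.prems by (auto simp: funpow_swap1)
    define c :: 'a where "c = - inverse 2"
    have "shift s (c *s (q + q1)) = c *s (shift s q + shift (- s) q)"
      by (simp add: shift.scale shift.add q1(2))
    also have "\<dots> = q"
      unfolding shift_plus_shift_uminus using assms by (simp add: c_def)
    finally show ?case
      using q q1(1) by (intro bexI[of _ "c *s (q + q1)"])
        (auto intro: subspace_add subspace_scale subspace_unipotent_part)
  qed
qed

text \<open>Double induction on the two nilpotency indices: \<open>shift s x\<close> and
  \<open>shift (- s) x\<close> vanish by induction, and their sum is \<open>- 2 x\<close>.\<close>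

lemma unipotent_part_Int_uminus:
  assumes "(2 :: 'a) \<noteq> 0"
  shows "unipotent_part s \<inter> unipotent_part (- s) = {0}"
proof -
  have "x = 0" if "(shift s ^^ m) x = 0" "(shift (- s) ^^ n) x = 0" for m n x
    using that
  proof (induction m arbitrary: n x)
    case (Suc m)
    note IH = Suc.IH
    from Suc.prems(2) Suc.prems(1) show ?case
    proof (induction n arbitrary: x)
      case (Suc n)
      have "(shift s ^^ m) (shift s x) = 0" using Suc.prems(2) by (simp add: funpow_swap1)
      moreover have "(shift (- s) ^^ Suc n) (shift s x) = 0"
        using Suc.prems(1) funpow_shift_commute[where s = "- s" and t = s and m = "Suc n"] shift.zero by metis
      ultimately have 1: "shift s x = 0" by (rule IH)
      have "(shift (- s) ^^ n) (shift (- s) x) = 0" using Suc.prems(1) by (simp add: funpow_swap1)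
      moreover have "(shift s ^^ Suc m) (shift (- s) x) = 0"
        using Suc.prems(2) funpow_shift_commute[where s = s and t = "- s" and m = "Suc m"] shift.zero by metis
      ultimately have 2: "shift (- s) x = 0" by (rule Suc.IH)
      show ?case using shift_plus_shift_uminus[of s x] 1 2 assms by simp
    qed simp
  qed simp
  then show ?thesis
    using subspace_0[OF subspace_unipotent_part] unfolding unipotent_part_def by fast
qed

lemma exists_shift_basis_unipotent_part:
  assumes "unipotent_part s = span (range (e :: nat \<Rightarrow> 'b))"
  obtains B d where "independent B" "span B = unipotent_part s"
    "\<forall>b\<in>B. s *s u b - b \<in> (case d b of 0 \<Rightarrow> {0} | Suc j \<Rightarrow> span {b' \<in> B. d b' = j})"
proof -
  interpret nilpotent_part scale "unipotent_part s" "shift s"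
    by unfold_locales
      (auto simp: subspace_unipotent_part shift.add shift.scale shift_in_unipotent_part)
  note result = that
  show ?thesis
  proof (rule exists_shift_basis[OF _ assms])
    show "\<exists>m. (shift s ^^ m) w = 0" if "w \<in> unipotent_part s" for w
      using that by (simp add: unipotent_part_def)
    show ?thesis if "independent B" "span B = unipotent_part s"
      "\<And>b. b \<in> B \<Longrightarrow> shift s b \<in> (case d b of 0 \<Rightarrow> {0} | Suc j \<Rightarrow> span {b' \<in> B. d b' = j})" for B d
      using that(3) unfolding shift_def by (intro result[OF that(1,2)] ballI)
  qed
qed

text \<open>In characteristic 2 the signs coincide and the part for 1 is the whole space. Otherwise
  the parts for 1 and -1 form a direct sum, which triangularity shows to contain each
  \<open>e n\<close> in turn.\<close>

lemma exists_inverting_involution: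
  fixes e :: "nat \<Rightarrow> 'b" and \<delta> :: "nat \<Rightarrow> 'a"
  assumes e: "span (range e) = UNIV"
    and \<delta>: "\<And>n. \<delta> n = 1 \<or> \<delta> n = - 1"
    and tri: "\<And>n. u (e n) - \<delta> n *s e n \<in> span (e ` {..<n})"
  obtains S where "Vector_Spaces.linear scale scale S" "\<And>x. S (S x) = x" "\<And>x. u (S (u x)) = S x"
proof -
  have \<delta>\<delta>: "\<delta> n * \<delta> n = 1" for n using \<delta>[of n] by auto
  have low: "shift (\<delta> n) (e n) \<in> span (e ` {..<n})" for n
  proof -
    have "shift (\<delta> n) (e n) = \<delta> n *s (u (e n) - \<delta> n *s e n)"
      by (simp add: shift_def scale_right_diff_distrib \<delta>\<delta>)
    then show ?thesis using tri span_scale by metis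
  qed
  show ?thesis
  proof (cases "(2 :: 'a) = 0")
    case True
    then have "- 1 = (1 :: 'a)" by (metis eq_neg_iff_add_eq_0 one_add_one)
    then have \<delta>1: "\<delta> n = 1" for n using \<delta>[of n] by auto
    have "e n \<in> unipotent_part 1" for n
    proof (induction n rule: less_induct)
      case (less n)
      then have "span (e ` {..<n}) \<subseteq> unipotent_part 1"
        by (intro span_minimal) (auto simp: subspace_unipotent_part)
      then show ?case using low[of n] \<delta>1 by (auto intro: unipotent_partI_shift)
    qed
    then have "span (range e) \<subseteq> unipotent_part 1"
      by (intro span_minimal) (auto simp: subspace_unipotent_part)
    then have V: "unipotent_part 1 = UNIV" using e by blast
    obtain B d where B: "independent B" "span B = unipotent_part 1"
      "\<forall>b\<in>B. 1 *s u b - b \<in> (case d b of 0 \<Rightarrow> {0} | Suc j \<Rightarrow> span {b' \<in> B. d b' = j})"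
      by (rule exists_shift_basis_unipotent_part[OF trans[OF V e[symmetric]]]) (rule that; assumption)
    show ?thesis
    proof (rule exists_inverting_involution_of_basis[OF u _ B(1), of "\<lambda>_. 1" d])
      show "x = 0" if "u x = 0" for x using u_eq_0_unipotent_part[of x 1] V that by blast
      show "span B = UNIV" using B(2) V by simp
      show "(1::'a) * 1 = 1" by simp
      show "1 *s u b - b \<in> (case d b of 0 \<Rightarrow> {0} | Suc j \<Rightarrow> span {b' \<in> B. 1 = (1::'a) \<and> d b' = j})"
        if "b \<in> B" for b using B(3) that by (auto split: nat.splits)
    qed (rule that)
  next
    case False
    let ?V = "unipotent_part 1" and ?W = "unipotent_part (- 1)"
    have disj: "?V \<inter> ?W = {0}" using unipotent_part_Int_uminus[OF False] .
    have "\<exists>p q. p \<in> ?V \<and> q \<in> ?W \<and> e n = p + q" for n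
    proof (induction n rule: less_induct)
      case (less n)
      have "span (e ` {..<n}) \<subseteq> {p + q | p q. p \<in> ?V \<and> q \<in> ?W}"
      proof (intro span_minimal subspace_sums subspace_unipotent_part)
        show "e ` {..<n} \<subseteq> {p + q | p q. p \<in> ?V \<and> q \<in> ?W}" using less by blast
      qed
      then obtain p q where pq: "p \<in> ?V" "q \<in> ?W" "shift (\<delta> n) (e n) = p + q" using low[of n] by blast
      \<comment> \<open>Subtracting a preimage \<open>q'\<close> of \<open>q\<close> from
        \<open>e n\<close> leaves a vector that \<open>shift s\<close> sends into the part for
        \<open>s\<close>, so it lies in that part itself.\<close>
      have split: "\<exists>a b. a \<in> unipotent_part s \<and> b \<in> unipotent_part (- s) \<and> e n = a + b"
        if "p \<in> unipotent_part s" "q \<in> unipotent_part (- s)" "shift s (e n) = p + q" for s p q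
      proof -
        obtain q' where q': "q' \<in> unipotent_part (- s)" "shift s q' = q"
          using shift_onto_unipotent_part_uminus[OF False \<open>q \<in> unipotent_part (- s)\<close>] by blast
        have "shift s (e n - q') = p" using that(3) q'(2) by (simp add: shift.diff)
        with that(1) have "shift s (e n - q') \<in> unipotent_part s" by (simp only:)
        then have "e n - q' \<in> unipotent_part s" by (rule unipotent_partI_shift)
        with q'(1) show ?thesis by (intro exI[of _ "e n - q'"] exI[of _ q']) simp
      qed
      show ?case
      proof (cases "\<delta> n = 1")
        case True
        then show ?thesis using split[of p 1 q] pq by simp
      next
        case False
        then have "\<delta> n = - 1" using \<delta> by blast
        then obtain a b where "a \<in> ?W" "b \<in> ?V" "e n = a + b"
          using split[of q "- 1" p] pq by (auto simp: add.commute)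
        then show ?thesis by (metis add.commute)
      qed
    qed
    then obtain p q where pq: "\<And>n. p n \<in> ?V" "\<And>n. q n \<in> ?W" "\<And>n. e n = p n + q n" by metis
    have pV: "span (range p) \<subseteq> ?V"
      by (intro span_minimal subspace_unipotent_part) (use pq(1) in blast)
    have qW: "span (range q) \<subseteq> ?W"
      by (intro span_minimal subspace_unipotent_part) (use pq(2) in blast)
    have all: "\<exists>a b. a \<in> span (range p) \<and> b \<in> span (range q) \<and> x = a + b" for x
    proof -
      have "range e \<subseteq> {a + b | a b. a \<in> span (range p) \<and> b \<in> span (range q)}"
        using pq(3) span_base by blast
      then have "span (range e) \<subseteq> {a + b | a b. a \<in> span (range p) \<and> b \<in> span (range q)}"
        by (intro span_minimal subspace_sums) auto
      then have "x \<in> {a + b | a b. a \<in> span (range p) \<and> b \<in> span (range q)}" using e by blast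
      then show ?thesis by blast
    qed
    \<comment> \<open>The basis construction needs a countable spanning set of each part; the
      components of the \<open>e n\<close> supply it.\<close>
    have Vp: "?V = span (range p)"
    proof
      show "?V \<subseteq> span (range p)"
      proof
        fix x assume x: "x \<in> ?V"
        obtain a b where ab: "a \<in> span (range p)" "b \<in> span (range q)" "x = a + b" using all by blast
        then have "b = x - a" by simp
        then have "b \<in> ?V" using x ab(1) pV subspace_diff[OF subspace_unipotent_part] by blast
        then have "b = 0" using ab(2) qW disj by blast
        then show "x \<in> span (range p)" using ab by simp
      qed
    qed (rule pV)
    have Wq: "?W = span (range q)"
    proof
      show "?W \<subseteq> span (range q)"
      proof
        fix x assume x: "x \<in> ?W"
        obtain a b where ab: "a \<in> span (range p)" "b \<in> span (range q)" "x = a + b" using all by blast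
        then have "a = x - b" by simp
        then have "a \<in> ?W" using x ab(2) qW subspace_diff[OF subspace_unipotent_part] by blast
        then have "a = 0" using ab(1) pV disj by blast
        then show "x \<in> span (range q)" using ab by simp
      qed
    qed (rule qW)
    obtain B1 d1 where B1: "independent B1" "span B1 = ?V"
      "\<forall>b\<in>B1. 1 *s u b - b \<in> (case d1 b of 0 \<Rightarrow> {0} | Suc j \<Rightarrow> span {b' \<in> B1. d1 b' = j})"
      by (rule exists_shift_basis_unipotent_part[OF Vp]) (rule that; assumption)
    obtain B2 d2 where B2: "independent B2" "span B2 = ?W"
      "\<forall>b\<in>B2. (- 1) *s u b - b \<in> (case d2 b of 0 \<Rightarrow> {0} | Suc j \<Rightarrow> span {b' \<in> B2. d2 b' = j})"
      by (rule exists_shift_basis_unipotent_part[OF Wq]) (rule that; assumption)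
    have B12: "b \<notin> B1" if b: "b \<in> B2" for b
    proof
      assume "b \<in> B1"
      then have "b = 0" using b span_base B1(2) B2(2) disj by blast
      then show False using B2(1) b dependent_zero by blast
    qed
    define \<sigma> :: "'b \<Rightarrow> 'a" where "\<sigma> b = (if b \<in> B1 then 1 else - 1)" for b
    define d where "d b = (if b \<in> B1 then d1 b else d2 b)" for b
    show ?thesis
    proof (rule exists_inverting_involution_of_basis[OF u, of "B1 \<union> B2" \<sigma> d])
      show "x = 0" if ux: "u x = 0" for x
      proof -
        obtain a b where ab: "a \<in> ?V" "b \<in> ?W" "x = a + b" using all Vp Wq by blast
        \<comment> \<open>Both parts are invariant under \<open>u\<close> and meet only in 0, so
          injectivity reduces to each part.\<close>
        have "u a = - u b" using ux ab(3) by (simp add: u.add eq_neg_iff_add_eq_0)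
        then have "u a \<in> ?W" using u_in_unipotent_part[OF ab(2)] subspace_neg[OF subspace_unipotent_part]
          by metis
        then have "u a = 0" using u_in_unipotent_part[OF ab(1)] disj by blast
        moreover from this have "u b = 0" using \<open>u a = - u b\<close> by simp
        ultimately have "a = 0" "b = 0" using ab(1,2) u_eq_0_unipotent_part by blast+
        then show ?thesis using ab(3) by simp
      qed
      show "independent (B1 \<union> B2)"
        using independent_Un_of_Int_span B1(1,2) B2(1,2) disj by metis
      have "x \<in> span (B1 \<union> B2)" for x
        using all[of x] unfolding span_Un B1(2) B2(2) Vp[symmetric] Wq[symmetric] by blast
      then show "span (B1 \<union> B2) = UNIV" by blast
      show "\<sigma> b * \<sigma> b = 1" for b by (simp add: \<sigma>_def)
      show "\<sigma> b *s u b - b \<in> (case d b of 0 \<Rightarrow> {0} | Suc j \<Rightarrow>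
          span {b' \<in> B1 \<union> B2. \<sigma> b' = \<sigma> b \<and> d b' = j})" if b: "b \<in> B1 \<union> B2" for b
      proof (cases "b \<in> B1")
        case True
        have "{b' \<in> B1. d1 b' = j} \<subseteq> {b' \<in> B1 \<union> B2. \<sigma> b' = \<sigma> b \<and> d b' = j}" for j
          using True by (auto simp: \<sigma>_def d_def)
        then have sub: "span {b' \<in> B1. d1 b' = j} \<subseteq> span {b' \<in> B1 \<union> B2. \<sigma> b' = \<sigma> b \<and> d b' = j}" for j
          by (rule span_mono)
        have eq: "d b = d1 b" "\<sigma> b *s u b - b = 1 *s u b - b"
          using True by (auto simp: \<sigma>_def d_def)
        show ?thesis
          unfolding eq using bspec[OF B1(3) True] sub by (cases "d1 b") auto
      next
        case False
        then have b2: "b \<in> B2" using b by blast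
        have "{b' \<in> B2. d2 b' = j} \<subseteq> {b' \<in> B1 \<union> B2. \<sigma> b' = \<sigma> b \<and> d b' = j}" for j
          using False B12 by (auto simp: \<sigma>_def d_def)
        then have sub: "span {b' \<in> B2. d2 b' = j} \<subseteq> span {b' \<in> B1 \<union> B2. \<sigma> b' = \<sigma> b \<and> d b' = j}" for j
          by (rule span_mono)
        have eq: "d b = d2 b" "\<sigma> b *s u b - b = (- 1) *s u b - b"
          using False by (auto simp: \<sigma>_def d_def)
        show ?thesis
          unfolding eq using bspec[OF B2(3) b2] sub by (cases "d2 b") auto
      qed
    qed (rule that)
  qed
qed

end

end

subsection \<open>Column-finite matrices\<close>

lemma vector_space_smult: "vector_space (smult :: 'a::field \<Rightarrow> 'a poly \<Rightarrow> 'a poly)"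
  by unfold_locales (simp_all add: smult_add_right smult_add_left)

text \<open>Column-finite matrices act on finitely supported column vectors, modelled as polynomials:
  column \<open>j\<close> is the image of \<open>monom 1 j\<close>.\<close>

definition matrix_of :: "('a::field poly \<Rightarrow> 'a poly) \<Rightarrow> 'a cf_matrix" where
  "matrix_of L = Cf_Matrix (\<lambda>i j. coeff (L (monom 1 j)) i)"

lemma entry_matrix_of: "entry (matrix_of L) i j = coeff (L (monom 1 j)) i"
proof -
  have "finite {i. coeff (L (monom 1 j)) i \<noteq> 0}" for j
    by (rule finite_subset[of _ "{..degree (L (monom 1 j))}"]) (auto simp: le_degree)
  then show ?thesis unfolding matrix_of_def by (subst Cf_Matrix_inverse) auto
qed

lemma matrix_of_comp:
  assumes "Vector_Spaces.linear smult smult L"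
  shows "matrix_of (\<lambda>x. L (M x)) = matrix_of L * matrix_of M"
proof (rule cf_matrix_eqI)
  fix i j
  interpret L: Vector_Spaces.linear smult smult L by (rule assms)
  let ?m = "M (monom 1 j)"
  have "?m = (\<Sum>k\<le>degree ?m. smult (coeff ?m k) (monom 1 k))"
    using poly_as_sum_of_monoms[of ?m] by (simp add: smult_monom)
  then have "L ?m = L (\<Sum>k\<le>degree ?m. smult (coeff ?m k) (monom 1 k))" by simp
  also have "\<dots> = (\<Sum>k\<le>degree ?m. smult (coeff ?m k) (L (monom 1 k)))"
    by (simp only: L.sum L.scale)
  finally have "coeff (L ?m) i = (\<Sum>k\<le>degree ?m. coeff (L (monom 1 k)) i * coeff ?m k)"
    by (simp add: coeff_sum mult.commute)
  also have "\<dots> = entry (matrix_of L * matrix_of M) i j"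
    by (subst entry_times_eq_sum[of "{..degree ?m}"]) (auto simp: entry_matrix_of le_degree)
  finally show "entry (matrix_of (\<lambda>x. L (M x))) i j = entry (matrix_of L * matrix_of M) i j"
    by (simp add: entry_matrix_of)
qed

lemma matrix_of_ident: "matrix_of (\<lambda>x. x) = 1"
  by (rule cf_matrix_eqI) (auto simp: entry_matrix_of one_cf_matrix.rep_eq)

definition column :: "'a::field cf_matrix \<Rightarrow> nat \<Rightarrow> 'a poly" where
  "column U j = Abs_poly (\<lambda>i. entry U i j)"

lemma coeff_column: "coeff (column U j) i = entry U i j"
proof -
  have "\<forall>\<^sub>\<infinity>i. entry U i j = 0" using finite_column[of U j] by (simp add: MOST_iff_cofinite)
  then show ?thesis unfolding column_def by (simp add: Abs_poly_inverse)
qed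

definition operator_of :: "'a::field cf_matrix \<Rightarrow> 'a poly \<Rightarrow> 'a poly" where
  "operator_of U p = (\<Sum>j\<le>degree p. smult (coeff p j) (column U j))"

text \<open>A free upper bound lets polynomials of different degrees share one range of
  summation.\<close>

lemma operator_of_eq_sum:
  assumes "degree p \<le> n"
  shows "operator_of U p = (\<Sum>j\<le>n. smult (coeff p j) (column U j))"
  unfolding operator_of_def
  by (rule sum.mono_neutral_left) (use assms in \<open>auto simp: coeff_eq_0\<close>)

lemma linear_operator_of: "Vector_Spaces.linear smult smult (operator_of U)"
proof -
  have "operator_of U (p + q) = operator_of U p + operator_of U q" for p q
  proof -
    let ?n = "max (degree p) (degree q)"
    have "degree (p + q) \<le> ?n" by (simp add: degree_add_le)
    then show ?thesis
      using operator_of_eq_sum[of "p + q" ?n U] operator_of_eq_sum[of p ?n U] operator_of_eq_sum[of q ?n U]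
      by (simp add: smult_add_left sum.distrib)
  qed
  moreover have "operator_of U (smult c p) = smult c (operator_of U p)" for c p
    using operator_of_eq_sum[of "smult c p" "degree p" U] operator_of_eq_sum[of p "degree p" U]
    by (simp add: degree_smult_le module.scale_sum_right[OF vector_space_smult[unfolded module_iff_vector_space[symmetric]]])
  ultimately show ?thesis by (simp add: Vector_Spaces.linear_iff vector_space_smult)
qed

lemma operator_of_monom: "operator_of U (monom 1 j) = column U j"
proof -
  have "operator_of U (monom 1 j) = (\<Sum>k\<le>j. smult (coeff (monom 1 j) k) (column U k))"
    by (rule operator_of_eq_sum) (rule degree_monom_le)
  also have "\<dots> = (\<Sum>k\<le>j. if k = j then column U k else 0)"
    by (rule sum.cong) auto
  finally show ?thesis by simp
qed

lemma matrix_of_operator_of: "matrix_of (operator_of U) = U"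
  by (rule cf_matrix_eqI) (simp add: entry_matrix_of operator_of_monom coeff_column)

lemma span_monom_lessThan:
  assumes "\<And>i. i \<ge> n \<Longrightarrow> coeff p i = 0"
  shows "p \<in> module.span smult (monom (1::'a::field) ` {..<n})"
proof -
  interpret vector_space "smult :: 'a \<Rightarrow> _" by (rule vector_space_smult)
  have eq: "(\<Sum>k\<le>degree p. smult (coeff p k) (monom 1 k)) = p"
    using poly_as_sum_of_monoms[of p] by (simp add: smult_monom)
  have "smult (coeff p k) (monom 1 k) \<in> span (monom 1 ` {..<n})" for k
    using assms[of k] by (cases "k < n") (auto intro: span_scale span_base span_zero)
  then have "(\<Sum>k\<le>degree p. smult (coeff p k) (monom 1 k)) \<in> span (monom 1 ` {..<n})"
    by (intro span_sum)
  then show ?thesis by (simp only: eq)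
qed

theorem theorem1p10:
  fixes U :: "'a::field cf_matrix"
  assumes "upper_triangular U"
    and "\<forall>i. entry U i i = 1 \<or> entry U i i = -1"
  shows "\<exists>A B. A \<in> GL_Cf \<and> B \<in> GL_Cf \<and> involution A \<and> involution B \<and> U = A * B"
proof -
  interpret vector_space "smult :: 'a \<Rightarrow> _" by (rule vector_space_smult)
  let ?u = "operator_of U"
  \<comment> \<open>Once its diagonal entry is removed, column \<open>n\<close> is supported in rows
    \<open>i < n\<close>.\<close>
  have tri: "?u (monom 1 n) - smult (entry U n n) (monom 1 n) \<in> span (monom 1 ` {..<n})" for n
    by (rule span_monom_lessThan)
      (use assms(1) in \<open>auto simp: operator_of_monom coeff_column upper_triangular_def\<close>)
  have "p \<in> span (range (monom (1::'a)))" for p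
    using span_monom_lessThan[of "Suc (degree p)" p] span_mono[of "monom 1 ` {..<Suc (degree p)}" "range (monom 1)"]
    by (auto simp: coeff_eq_0)
  then have sp: "span (range (monom (1::'a))) = UNIV" by blast
  obtain S where S: "Vector_Spaces.linear smult smult S" "\<And>x. S (S x) = x" "\<And>x. ?u (S (?u x)) = S x"
    by (rule exists_inverting_involution[OF linear_operator_of sp _ tri]) (use assms(2) in blast)+
  define A where "A = U * matrix_of S"
  define B where "B = matrix_of S"
  have BB: "B * B = 1" using matrix_of_comp[OF S(1), of S] by (simp add: B_def S(2) matrix_of_ident)
  have "matrix_of (\<lambda>x. ?u (S (?u x))) = U * (B * U)"
    unfolding matrix_of_comp[OF linear_operator_of, of U "\<lambda>x. S (?u x)"]
      matrix_of_comp[OF S(1), of ?u] matrix_of_operator_of B_def ..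
  then have UBU: "U * (B * U) = B" unfolding S(3) B_def[symmetric] by (rule sym)
  have "A * A = (U * (B * U)) * B" by (simp add: A_def B_def mult.assoc)
  then have AA: "A * A = 1" using UBU BB by simp
  have "U = A * B" using BB by (simp add: A_def B_def mult.assoc)
  \<comment> \<open>An involution is its own inverse, which gives membership in
    \<open>GL_Cf\<close>.\<close>
  with AA BB show ?thesis unfolding GL_Cf_def involution_def by blast
qed

end
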